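(* Let $m\ge1$, $1<p_i<\infty$ for $i=1,\dots,m$, and $\frac1p=\frac1{p_1}+\dots+\frac1{p_m}$. Let $v$ and $w_1,\dots,w_m$ be weights on $\mathbb{R}^n$, and let $\sigma_i=w_i^{1-p_i'}$. Suppose that $\overrightarrow w=(w_1,\dots,w_m)\in RH_{\overrightarrow P}$. Then there exists a positive constant $C$ such that $$\|\mathcal{M}(\overrightarrow{f\sigma})\|_{L^p(v)}\le C\prod_{i=1}^m\|f_i\|_{L^{p_i}(\sigma_i)}\qquad\text{for all } f_i\in L^{p_i}(\sigma_i),\ i=1,\dots,m,$$ if and only if $(v,\overrightarrow w)\in S_{\overrightarrow P}$. Moreover, if $\|\mathcal{M}\|$ denotes the smallest constant $C$ in this inequality, then $$[v,\overrightarrow w]_{S_{\overrightarrow P}}\lesssim\|\mathcal{M}\|\lesssim[v,\overrightarrow w]_{S_{\overrightarrow P}}\,[\overrightarrow w]_{RH_{\overrightarrow P}}^{1/p}.$$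
   Context: A weight is a locally integrable function on $\mathbb{R}^n$ that is positive almost everywhere; the functions $\sigma_i=w_i^{1-p_i'}$ are also understood to be weights. Here $p_i'=p_i/(p_i-1)$, $\overrightarrow P=(p_1,\dots,p_m)$, $\sigma(E)=\int_E\sigma\,dx$, and $\|f\|_{L^q(\sigma)}=\big(\int_{\mathbb{R}^n}|f|^q\sigma\,dx\big)^{1/q}$. All suprema are over cubes $Q\subset\mathbb{R}^n$. The multisublinear maximal function of $\overrightarrow g=(g_1,\dots,g_m)$ is $$\mathcal{M}(\overrightarrow g)(x)=\sup_{Q\ni x}\prod_{i=1}^m\frac{1}{|Q|}\int_Q|g_i(y_i)|\,dy_i,$$ the supremum being over all cubes $Q$ containing $x$. Write $\overrightarrow{f\sigma}=(f_1\sigma_1,\dots,f_m\sigma_m)$ and $\overrightarrow{\sigma\chi_Q}=(\sigma_1\chi_Q,\dots,\sigma_m\chi_Q)$. $(v,\overrightarrow w)\in S_{\overrightarrow P}$ means $$[v,\overrightarrow w]_{S_{\overrightarrow P}}:=\sup_Q\Big(\int_Q\mathcal{M}(\overrightarrow{\sigma\chi_Q})^p\,v\,dx\Big)^{1/p}\Big(\prod_{i=1}^m\sigma_i(Q)^{1/p_i}\Big)^{-1}<\infty.$$ $\overrightarrow w\in RH_{\overrightarrow P}$ means that there is a positive constant $C$ such that for every cube $Q$ $$\prod_{i=1}^m\Big(\int_Q\sigma_i\,dx\Big)^{p/p_i}\le C\int_Q\prod_{i=1}^m\sigma_i^{p/p_i}\,dx,$$ and $[\overrightarrow w]_{RH_{\overrightarrow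 P}}$ denotes the smallest such $C$. $A\lesssim B$ means $A\le cB$ with a constant $c$ independent of the weights and of the weight constants ($c$ may depend on $n$, $m$ and $\overrightarrow P$). *)

theory Defs
  imports "HOL-Analysis.Analysis"
begin

text \<open>
  All integrals are Lebesgue integrals with values in \<^typ>\<open>ennreal\<close>, so that norms, averages and
  weight constants are defined without any finiteness assumption; finiteness is always stated
  explicitly. Families indexed by \<open>1, \<dots>, m\<close> are functions on \<^typ>\<open>nat\<close> of which only
  the values on \<open>{1..m}\<close> are used.
\<close>

text \<open>Powers in \<open>[0, \<infinity>]\<close>; only used for exponents \<open>a > 0\<close>.\<close>

definition epowr :: "ennreal \<Rightarrow> real \<Rightarrow> ennreal"
  where "epowr x a = (if x = \<infinity> then \<infinity> else ennreal (enn2real x powr a))"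

definition conj_exp :: "real \<Rightarrow> real"
  where "conj_exp q = q / (q - 1)"

text \<open>Nondegenerate closed cubes with sides parallel to the coordinate axes.\<close>

definition cubes :: "(real ^ 'n) set set"
  where "cubes = {cbox a (a + (\<chi> i. l)) | a l. 0 < l}"

text \<open>A weight may take arbitrary values on a null set; negative values there are truncated to
  \<open>0\<close> by \<^const>\<open>ennreal\<close> below, which does not affect any integral.\<close>

definition weight :: "(real ^ 'n \<Rightarrow> real) \<Rightarrow> bool"
  where "weight w \<longleftrightarrow>
    (\<forall>K. compact K \<longrightarrow> w absolutely_integrable_on K) \<and> (AE x in lebesgue. 0 < w x)"

definition dual_weight :: "real \<Rightarrow> (real ^ 'n \<Rightarrow> real) \<Rightarrow> real ^ 'n \<Rightarrow> real"
  where "dual_weight q w x = w x powr (1 - conj_exp q)"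

definition weight_measure :: "(real ^ 'n \<Rightarrow> real) \<Rightarrow> (real ^ 'n) set \<Rightarrow> ennreal"
  where "weight_measure \<sigma> E = (\<integral>\<^sup>+x\<in>E. ennreal (\<sigma> x) \<partial>lebesgue)"

text \<open>The norm of \<open>L\<^sup>q(\<sigma>)\<close>, applied to the modulus of the function (the maximal function below is
  itself \<open>[0, \<infinity>]\<close>-valued).\<close>

definition Lnorm :: "real \<Rightarrow> (real ^ 'n \<Rightarrow> real) \<Rightarrow> (real ^ 'n \<Rightarrow> ennreal) \<Rightarrow> ennreal"
  where "Lnorm q \<sigma> F = epowr (\<integral>\<^sup>+x. epowr (F x) q * ennreal (\<sigma> x) \<partial>lebesgue) (1 / q)"

definition Lspace :: "real \<Rightarrow> (real ^ 'n \<Rightarrow> real) \<Rightarrow> (real ^ 'n \<Rightarrow> real) set"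
  where "Lspace q \<sigma> =
    {f. f \<in> borel_measurable lebesgue \<and> Lnorm q \<sigma> (\<lambda>x. ennreal \<bar>f x\<bar>) < \<infinity>}"

definition multi_maximal :: "nat \<Rightarrow> (nat \<Rightarrow> real ^ 'n \<Rightarrow> real) \<Rightarrow> real ^ 'n \<Rightarrow> ennreal"
  where "multi_maximal m g x =
    (SUP Q \<in> {Q \<in> cubes. x \<in> Q}.
      \<Prod>i\<in>{1..m}. (\<integral>\<^sup>+y\<in>Q. ennreal \<bar>g i y\<bar> \<partial>lebesgue) / emeasure lebesgue Q)"

text \<open>The two-weight strong-type inequality with constant \<open>C\<close>, where \<open>\<sigma>\<^sub>i\<close> is the dual weight of
  \<open>w\<^sub>i\<close>, and the smallest such constant (\<open>\<infinity>\<close> if there is none).\<close>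

definition maximal_bound ::
  "nat \<Rightarrow> (nat \<Rightarrow> real) \<Rightarrow> real \<Rightarrow> (real ^ 'n \<Rightarrow> real) \<Rightarrow> (nat \<Rightarrow> real ^ 'n \<Rightarrow> real) \<Rightarrow> real \<Rightarrow> bool"
  where "maximal_bound m P p v w C \<longleftrightarrow>
    (\<forall>f. (\<forall>i\<in>{1..m}. f i \<in> Lspace (P i) (dual_weight (P i) (w i))) \<longrightarrow>
      Lnorm p v (multi_maximal m (\<lambda>i x. f i x * dual_weight (P i) (w i) x))
        \<le> ennreal C * (\<Prod>i\<in>{1..m}. Lnorm (P i) (dual_weight (P i) (w i)) (\<lambda>x. ennreal \<bar>f i x\<bar>)))"

definition maximal_norm ::
  "nat \<Rightarrow> (nat \<Rightarrow> real) \<Rightarrow> real \<Rightarrow> (real ^ 'n \<Rightarrow> real) \<Rightarrow> (nat \<Rightarrow> real ^ 'n \<Rightarrow> real) \<Rightarrow> ennreal"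
  where "maximal_norm m P p v w = (INF C \<in> {C. 0 < C \<and> maximal_bound m P p v w C}. ennreal C)"

definition S_const ::
  "nat \<Rightarrow> (nat \<Rightarrow> real) \<Rightarrow> real \<Rightarrow> (real ^ 'n \<Rightarrow> real) \<Rightarrow> (nat \<Rightarrow> real ^ 'n \<Rightarrow> real) \<Rightarrow> ennreal"
  where "S_const m P p v w =
    (SUP Q \<in> cubes.
      epowr (\<integral>\<^sup>+x\<in>Q. epowr (multi_maximal m (\<lambda>i y. dual_weight (P i) (w i) y * indicator Q y) x) p
               * ennreal (v x) \<partial>lebesgue) (1 / p)
      / (\<Prod>i\<in>{1..m}. epowr (weight_measure (dual_weight (P i) (w i)) Q) (1 / P i)))"

definition S_class ::
  "nat \<Rightarrow> (nat \<Rightarrow> real) \<Rightarrow> real \<Rightarrow> (real ^ 'n \<Rightarrow> real) \<Rightarrow> (nat \<Rightarrow> real ^ 'n \<Rightarrow> real) \<Rightarrow> bool"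
  where "S_class m P p v w \<longleftrightarrow> S_const m P p v w < \<infinity>"

definition RH_bound ::
  "nat \<Rightarrow> (nat \<Rightarrow> real) \<Rightarrow> real \<Rightarrow> (nat \<Rightarrow> real ^ 'n \<Rightarrow> real) \<Rightarrow> real \<Rightarrow> bool"
  where "RH_bound m P p w C \<longleftrightarrow>
    (\<forall>Q\<in>cubes.
      (\<Prod>i\<in>{1..m}. epowr (weight_measure (dual_weight (P i) (w i)) Q) (p / P i))
        \<le> ennreal C *
          (\<integral>\<^sup>+x\<in>Q. (\<Prod>i\<in>{1..m}. ennreal (dual_weight (P i) (w i) x powr (p / P i))) \<partial>lebesgue))"

definition RH_class ::
  "nat \<Rightarrow> (nat \<Rightarrow> real) \<Rightarrow> real \<Rightarrow> (nat \<Rightarrow> real ^ 'n \<Rightarrow> real) \<Rightarrow> bool"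
  where "RH_class m P p w \<longleftrightarrow> (\<exists>C>0. RH_bound m P p w C)"

definition RH_const ::
  "nat \<Rightarrow> (nat \<Rightarrow> real) \<Rightarrow> real \<Rightarrow> (nat \<Rightarrow> real ^ 'n \<Rightarrow> real) \<Rightarrow> ennreal"
  where "RH_const m P p w = (INF C \<in> {C. 0 < C \<and> RH_bound m P p w C}. ennreal C)"

end

theory Submission
  imports Defs
begin

text \<open>
  Necessity of the testing condition is seen by inserting \<open>f\<^sub>i = \<chi>\<^sub>Q\<close> into the inequality, and
  gives \<open>[v, w]\<^sub>S \<le> \<parallel>M\<parallel>\<close>. The content is the converse.

  By the one-third trick every cube lies in a cell of comparable size of one of \<open>2\<^sup>n\<close> translated
  dyadic grids, so the maximal function is bounded by finitely many dyadic ones, up to a limit in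
  which the largest side length of the grids tends to infinity. Each dyadic maximal function is a
  monotone limit of maximal functions of finite laminar families (any two members are disjoint or
  nested), and these are treated in an abstract measure space.

  Given such a family, its union splits into disjoint sets \<open>E(Q)\<close> on which the supremum is attained by
  its member \<open>Q\<close>. The average of \<open>f\<^sub>i \<sigma>\<^sub>i\<close> over \<open>Q\<close> is the average of \<open>\<sigma>\<^sub>i\<close> times the average of \<open>f\<^sub>i\<close> with
  respect to \<open>\<sigma>\<^sub>i dx\<close>. Hence the integral of the \<open>p\<close>-th power of the maximal function is a sum
  \<open>\<Sum>\<^sub>Q \<lambda>\<^sub>Q b\<^sub>Q\<^sup>p\<close>, where \<open>b\<^sub>Q\<close> is the product of the weighted averages of the \<open>f\<^sub>i\<close>, and \<open>\<lambda>\<^sub>Q\<close> is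
  \<open>v(E(Q))\<close> times the \<open>p\<close>-th power of the product of the averages of the \<open>\<sigma>\<^sub>i\<close>.

  For a fixed \<open>R\<close>, the sum of \<open>\<lambda>\<^sub>Q\<close> over \<open>Q \<subseteq> R\<close> is at most the integral in the testing condition
  for \<open>R\<close>. The testing condition bounds it by \<open>[v, w]\<^sub>S\<^sup>p \<Prod>\<^sub>i \<sigma>\<^sub>i(R)\<close> with exponents \<open>p / p\<^sub>i\<close> on the
  factors, and the reverse Hoelder condition bounds this product by a multiple of the measure of
  \<open>R\<close> with density \<open>\<Prod>\<^sub>i \<sigma>\<^sub>i\<close>, again with exponents \<open>p / p\<^sub>i\<close>. This is a Carleson packing condition, so the
  Carleson embedding (\<open>laminar_Carleson_embedding\<close>) bounds the sum by the integral of the \<open>p\<close>-th power of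
  the maximal function of the \<open>b\<^sub>Q\<close> against this density. Hoelder's inequality decouples that
  integral into the norms in \<open>L(\<sigma>\<^sub>i dx)\<close>, with exponents \<open>p\<^sub>i\<close>, of the weighted maximal functions of
  the \<open>f\<^sub>i\<close>. The weighted dyadic maximal operator is bounded with a constant that is the same for
  all weights (\<open>laminar_weighted_maximal_bound\<close>), by Doob's argument. The estimate
  \<open>laminar_testing_bound\<close> combines these steps.
\<close>

section \<open>Powers in \<open>[0, \<infinity>]\<close>\<close>

lemma epowr_ennreal: "epowr (ennreal r) a = ennreal ((max 0 r) powr a)"
  by (cases "0 \<le> r") (auto simp: epowr_def ennreal_neg max_def)

lemma epowr_top [simp]: "epowr top a = top"
  by (simp add: epowr_def)

lemma epowr_0 [simp]: "epowr 0 a = 0"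
  by (simp add: epowr_def)

lemma epowr_1 [simp]: "epowr 1 a = 1"
  by (simp add: epowr_def)

lemma epowr_exp_1 [simp]: "epowr x 1 = x"
  by (cases x) (auto simp: epowr_ennreal max_def)

lemma epowr_eq_top_iff [simp]: "epowr x a = top \<longleftrightarrow> x = top"
  by (simp add: epowr_def)

lemma epowr_less_top_iff [simp]: "epowr x a < top \<longleftrightarrow> x < top"
  by (metis epowr_eq_top_iff less_top)

lemma epowr_eq_0_iff [simp]: "epowr x a = 0 \<longleftrightarrow> x = 0"
  by (cases x) (auto simp: epowr_ennreal max_def)

lemma epowr_pos_iff [simp]: "0 < epowr x a \<longleftrightarrow> 0 < x"
  by (simp add: zero_less_iff_neq_zero)

lemma epowr_mono: "0 \<le> a \<Longrightarrow> x \<le> y \<Longrightarrow> epowr x a \<le> epowr y a"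
  by (cases x; cases y) (auto simp: epowr_ennreal max_def top_unique intro!: ennreal_leI powr_mono2)

lemma epowr_epowr: "epowr (epowr x a) b = epowr x (a * b)"
  by (cases x) (auto simp: epowr_ennreal max_def powr_powr)

lemma epowr_mult: "epowr (x * y) a = epowr x a * epowr y a"
proof (cases x; cases y)
  fix r s assume "x = ennreal r" "0 \<le> r" "y = ennreal s" "0 \<le> s"
  then show ?thesis
    by (simp add: epowr_ennreal max_def powr_mult flip: ennreal_mult)
qed (auto simp: epowr_def ennreal_mult_top ennreal_top_mult)

lemma epowr_prod: "epowr (\<Prod>i\<in>A. f i) a = (\<Prod>i\<in>A. epowr (f i) a)"
  by (induction A rule: infinite_finite_induct) (auto simp: epowr_mult)

lemma epowr_add: "0 < a \<Longrightarrow> 0 < b \<Longrightarrow> epowr x (a + b) = epowr x a * epowr x b"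
  by (cases x) (auto simp: epowr_ennreal max_def powr_add ennreal_mult)

text \<open>Raising to the power \<open>1 / a\<close> inverts raising to the power \<open>a\<close>, so the two form a Galois
connection. This turns norm inequalities into inequalities between integrals and makes powers
commute with suprema.\<close>

lemma epowr_le_iff:
  assumes "0 < a"
  shows "epowr x a \<le> y \<longleftrightarrow> x \<le> epowr y (1 / a)"
proof
  assume "epowr x a \<le> y"
  then have "epowr (epowr x a) (1 / a) \<le> epowr y (1 / a)"
    using assms by (intro epowr_mono) auto
  then show "x \<le> epowr y (1 / a)" using assms by (simp add: epowr_epowr)
next
  assume "x \<le> epowr y (1 / a)"
  then have "epowr x a \<le> epowr (epowr y (1 / a)) a"
    using assms by (intro epowr_mono) auto
  then show "epowr x a \<le> y" using assms by (simp add: epowr_epowr)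
qed

lemma epowr_SUP:
  assumes "0 < a"
  shows "epowr (SUP i\<in>I. f i) a = (SUP i\<in>I. epowr (f i) a)"
proof (rule antisym)
  show "epowr (SUP i\<in>I. f i) a \<le> (SUP i\<in>I. epowr (f i) a)"
    unfolding epowr_le_iff[OF assms]
    by (rule SUP_least) (auto simp flip: epowr_le_iff[OF assms] intro: SUP_upper)
  show "(SUP i\<in>I. epowr (f i) a) \<le> epowr (SUP i\<in>I. f i) a"
    using assms by (auto intro!: SUP_least epowr_mono SUP_upper)
qed

lemma borel_measurable_epowr [measurable]:
  assumes [measurable]: "f \<in> borel_measurable M"
  shows "(\<lambda>x. epowr (f x) a) \<in> borel_measurable M"
  unfolding epowr_def by measurable

section \<open>Distribution functions\<close>

text \<open>For finite \<open>y\<close> this is the integral of \<open>q t\<^sup>q\<^sup>-\<^sup>1\<close> over an interval; the value \<open>y = \<infinity>\<close> is reached by truncation.\<close>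

lemma epowr_eq_nn_integral:
  assumes q: "0 < q"
  shows "epowr y q
    = (\<integral>\<^sup>+t. ennreal (q * t powr (q - 1)) * indicator {t. 0 < t \<and> ennreal t < y} t \<partial>lborel)"
proof -
  have fin: "(\<integral>\<^sup>+t. ennreal (q * t powr (q - 1)) * indicator {t. 0 < t \<and> ennreal t < ennreal r} t \<partial>lborel)
      = ennreal (r powr q)" if "0 \<le> r" for r
  proof -
    have "((\<lambda>t. q * t powr (q - 1)) has_integral q * (r powr (q - 1 + 1) / (q - 1 + 1))) {0..r}"
      using q that by (intro has_integral_mult_right has_integral_powr_from_0) auto
    then have "((\<lambda>t. q * t powr (q - 1)) has_integral r powr q) {0..r}" using q by simp
    then have "(\<integral>\<^sup>+t. ennreal (indicator {0..r} t * (q * t powr (q - 1))) \<partial>lborel) = ennreal (r powr q)"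
      using q by (intro nn_integral_has_integral_lebesgue) auto
    moreover have "AE t in lborel. ennreal (indicator {0..r} t * (q * t powr (q - 1)))
        = ennreal (q * t powr (q - 1)) * indicator {t. 0 < t \<and> ennreal t < ennreal r} t"
      using AE_lborel_singleton[of 0] AE_lborel_singleton[of r]
    proof eventually_elim
      case (elim t)
      then show ?case using that
        by (auto simp: indicator_def ennreal_less_iff)
    qed
    ultimately show ?thesis by (simp add: nn_integral_cong_AE)
  qed
  show ?thesis
  proof (cases y)
    case (real r)
    then show ?thesis using fin[of r] by (simp add: epowr_ennreal max_def)
  next
    case top
    \<comment> \<open>the truncation at height \<open>n powr (1 / q)\<close> already contributes \<open>n\<close>\<close>
    have "ennreal (of_nat n)
       \<le> (\<integral>\<^sup>+t. ennreal (q * t powr (q - 1)) * indicator {t. 0 < t \<and> ennreal t < y} t \<partial>lborel)"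
      for n :: nat
    proof -
      have "ennreal (of_nat n) = ennreal ((of_nat n powr (1 / q)) powr q)"
        using q by (simp add: powr_powr)
      also have "\<dots> = (\<integral>\<^sup>+t. ennreal (q * t powr (q - 1))
          * indicator {t. 0 < t \<and> ennreal t < ennreal (of_nat n powr (1 / q))} t \<partial>lborel)"
        using fin[of "of_nat n powr (1 / q)"] by simp
      also have "\<dots> \<le> (\<integral>\<^sup>+t. ennreal (q * t powr (q - 1)) * indicator {t. 0 < t \<and> ennreal t < y} t \<partial>lborel)"
        using top by (intro nn_integral_mono mult_left_mono) (auto simp: indicator_def)
      finally show ?thesis .
    qed
    then show ?thesis
      using top ennreal_Ex_less_of_nat
      by (metis ennreal_of_nat_eq_real_of_nat epowr_top less_top not_less)
  qed
qed

text \<open>Tonelli's theorem applied to the previous formula. The weight \<open>h\<close> is kept as a factor of the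
integrand, so that one underlying measure serves all weights at once; over a counting measure the
formula also covers finite sums.\<close>

lemma (in sigma_finite_measure) layer_cake:
  assumes [measurable]: "g \<in> borel_measurable M" "h \<in> borel_measurable M" and q: "0 < q"
  shows "(\<integral>\<^sup>+x. epowr (g x) q * h x \<partial>M)
    = (\<integral>\<^sup>+t. ennreal (q * t powr (q - 1)) * indicator {0<..} t
        * (\<integral>\<^sup>+x. h x * indicator {x. ennreal t < g x} x \<partial>M) \<partial>lborel)"
proof -
  interpret pair_sigma_finite lborel M ..
  have "(\<integral>\<^sup>+x. epowr (g x) q * h x \<partial>M) = (\<integral>\<^sup>+x. (\<integral>\<^sup>+t. ennreal (q * t powr (q - 1))
      * indicator {t. 0 < t \<and> ennreal t < g x} t * h x \<partial>lborel) \<partial>M)"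
    by (simp add: epowr_eq_nn_integral[OF q] nn_integral_multc)
  also have "\<dots> = (\<integral>\<^sup>+x. (\<integral>\<^sup>+t. ennreal (q * t powr (q - 1)) * indicator {0<..} t
      * (h x * indicator {x. ennreal t < g x} x) \<partial>lborel) \<partial>M)"
    by (intro nn_integral_cong) (auto simp: indicator_def)
  also have "\<dots> = (\<integral>\<^sup>+t. (\<integral>\<^sup>+x. ennreal (q * t powr (q - 1)) * indicator {0<..} t
      * (h x * indicator {x. ennreal t < g x} x) \<partial>M) \<partial>lborel)"
    by (rule Fubini') measurable
  also have "\<dots> = (\<integral>\<^sup>+t. ennreal (q * t powr (q - 1)) * indicator {0<..} t
        * (\<integral>\<^sup>+x. h x * indicator {x. ennreal t < g x} x \<partial>M) \<partial>lborel)"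
    by (intro nn_integral_cong nn_integral_cmult) measurable
  finally show ?thesis .
qed

text \<open>A form of Young's inequality: where \<open>g\<close> is at least a large multiple
of \<open>f\<close>, the left-hand side is at most half of \<open>g\<^sup>q\<close>, and elsewhere \<open>g\<close> is controlled by \<open>f\<close>.\<close>

lemma absorb_pointwise:
  assumes q: "1 < q"
  shows "ennreal (q / (q - 1)) * (f * epowr g (q - 1))
    \<le> epowr g q / 2 + ennreal ((2 * q / (q - 1)) powr q) * epowr f q"
proof -
  \<comment> \<open>with this threshold the coefficient on the left is \<open>A / 2\<close>\<close>
  define A where "A = 2 * q / (q - 1)"
  have A: "A > 1" using q by (auto simp: A_def field_simps)
  have qA: "q / (q - 1) = A / 2" using q by (simp add: A_def field_simps)
  have eq: "x * epowr x (q - 1) = epowr x q" for x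
    using epowr_add[of 1 "q - 1" x] q by simp
  show ?thesis
  proof (cases "ennreal A * f \<le> g")
    case True
    have "ennreal (q / (q - 1)) * (f * epowr g (q - 1)) = (ennreal A * f / 2) * epowr g (q - 1)"
      unfolding qA using A by (simp add: ennreal_divide_numeral[symmetric] ennreal_times_divide mult_ac
        ennreal_divide_times)
    also have "\<dots> \<le> (g / 2) * epowr g (q - 1)"
      using True by (intro mult_right_mono divide_right_mono_ennreal) auto
    also have "\<dots> = epowr g q / 2"
      by (simp add: eq[symmetric] ennreal_times_divide ennreal_divide_times mult_ac)
    finally show ?thesis by (simp add: add_increasing2)
  next
    case False
    have "ennreal (q / (q - 1)) * (f * epowr g (q - 1)) \<le> ennreal A * (f * epowr (ennreal A * f) (q - 1))"
      using False q A unfolding qA by (intro mult_mono epowr_mono ennreal_leI) auto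
    also have "\<dots> = epowr (ennreal A * f) q"
      by (simp add: eq[symmetric] mult_ac)
    also have "\<dots> = ennreal (A powr q) * epowr f q"
      using A by (simp add: epowr_mult epowr_ennreal max_def)
    finally show ?thesis unfolding A_def by (simp add: add_increasing)
  qed
qed

text \<open>Doob's argument. Inserting the weak type estimate into the layer cake formula replaces the exponent
\<open>q\<close> by \<open>q - 1\<close> and bounds the integral of \<open>g\<^sup>q\<close> by a multiple of that of \<open>f g\<^sup>q\<^sup>-\<^sup>1\<close>. The pointwise inequality
above splits off half of the integral of \<open>g\<^sup>q\<close>, which may be subtracted because it is finite.\<close>

lemma (in sigma_finite_measure) strong_type_from_weak_type:
  assumes [measurable]: "f \<in> borel_measurable M" "g \<in> borel_measurable M" "s \<in> borel_measurable M"
    and q: "1 < q"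
    and weak: "\<And>t. 0 < t \<Longrightarrow> ennreal t * (\<integral>\<^sup>+x. s x * indicator {x. ennreal t < g x} x \<partial>M)
        \<le> (\<integral>\<^sup>+x. (f x * s x) * indicator {x. ennreal t < g x} x \<partial>M)"
    and fin: "(\<integral>\<^sup>+x. epowr (g x) q * s x \<partial>M) < \<infinity>"
  shows "(\<integral>\<^sup>+x. epowr (g x) q * s x \<partial>M)
    \<le> ennreal (2 * (2 * q / (q - 1)) powr q) * (\<integral>\<^sup>+x. epowr (f x) q * s x \<partial>M)"
    (is "?G \<le> _ * ?F")
proof -
  have "?G = (\<integral>\<^sup>+t. ennreal (q * t powr (q - 1)) * indicator {0<..} t
        * (\<integral>\<^sup>+x. s x * indicator {x. ennreal t < g x} x \<partial>M) \<partial>lborel)"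
    using q by (intro layer_cake) auto
  also have "\<dots> \<le> (\<integral>\<^sup>+t. ennreal (q / (q - 1)) * (ennreal ((q - 1) * t powr (q - 1 - 1)) * indicator {0<..} t
        * (\<integral>\<^sup>+x. (f x * s x) * indicator {x. ennreal t < g x} x \<partial>M)) \<partial>lborel)"
  proof (rule nn_integral_mono)
    fix t :: real
    show "ennreal (q * t powr (q - 1)) * indicator {0<..} t
        * (\<integral>\<^sup>+x. s x * indicator {x. ennreal t < g x} x \<partial>M)
      \<le> ennreal (q / (q - 1)) * (ennreal ((q - 1) * t powr (q - 1 - 1)) * indicator {0<..} t
        * (\<integral>\<^sup>+x. (f x * s x) * indicator {x. ennreal t < g x} x \<partial>M))"
    proof (cases "0 < t")
      case True
      have "q * t powr (q - 1) = (q * t powr (q - 1 - 1)) * t"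
        using True powr_add[of t "q - 1 - 1" 1] by simp
      then have "ennreal (q * t powr (q - 1)) * (\<integral>\<^sup>+x. s x * indicator {x. ennreal t < g x} x \<partial>M)
          = ennreal (q * t powr (q - 1 - 1)) * (ennreal t * (\<integral>\<^sup>+x. s x * indicator {x. ennreal t < g x} x \<partial>M))"
        using q True by (simp add: ennreal_mult mult.assoc)
      also have "\<dots> \<le> ennreal (q * t powr (q - 1 - 1)) * (\<integral>\<^sup>+x. (f x * s x) * indicator {x. ennreal t < g x} x \<partial>M)"
        by (intro mult_left_mono weak True) simp
      also have "ennreal (q * t powr (q - 1 - 1))
          = ennreal (q / (q - 1)) * ennreal ((q - 1) * t powr (q - 1 - 1))"
        using q by (simp flip: ennreal_mult)
      finally show ?thesis using True by (simp add: mult.assoc)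
    qed simp
  qed
  also have "\<dots> = ennreal (q / (q - 1)) * (\<integral>\<^sup>+t. ennreal ((q - 1) * t powr (q - 1 - 1)) * indicator {0<..} t
        * (\<integral>\<^sup>+x. (f x * s x) * indicator {x. ennreal t < g x} x \<partial>M) \<partial>lborel)"
    by (rule nn_integral_cmult) measurable
  also have "\<dots> = ennreal (q / (q - 1)) * (\<integral>\<^sup>+x. epowr (g x) (q - 1) * (f x * s x) \<partial>M)"
    using q by (subst layer_cake) auto
  also have "\<dots> = (\<integral>\<^sup>+x. ennreal (q / (q - 1)) * (f x * epowr (g x) (q - 1)) * s x \<partial>M)"
    by (subst nn_integral_cmult[symmetric]) (auto intro!: nn_integral_cong simp: mult_ac)
  also have "\<dots> \<le> (\<integral>\<^sup>+x. (epowr (g x) q / 2 + ennreal ((2 * q / (q - 1)) powr q) * epowr (f x) q) * s x \<partial>M)"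
    by (intro nn_integral_mono mult_right_mono absorb_pointwise q) simp
  also have "\<dots> = (\<integral>\<^sup>+x. (epowr (g x) q * s x) / 2 + ennreal ((2 * q / (q - 1)) powr q) * (epowr (f x) q * s x) \<partial>M)"
    by (intro nn_integral_cong) (simp add: distrib_right distrib_left mult_ac ennreal_times_divide ennreal_divide_times)
  also have "\<dots> = ?G / 2 + ennreal ((2 * q / (q - 1)) powr q) * ?F"
    by (simp add: nn_integral_add nn_integral_cmult nn_integral_divide)
  \<comment> \<open>\<open>?G / 2\<close> is finite and can be subtracted from both sides\<close>
  finally have le: "?G \<le> ?G / 2 + ennreal ((2 * q / (q - 1)) powr q) * ?F" .
  obtain r where r: "?G = ennreal r" "0 \<le> r" using fin by (cases ?G) auto
  show ?thesis
  proof (cases "ennreal ((2 * q / (q - 1)) powr q) * ?F")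
    case (real u)
    have "?G / 2 = ennreal (r / 2)" using r by (simp add: ennreal_divide_numeral)
    then have "ennreal r \<le> ennreal (r / 2 + u)" using le real r by simp
    then have "r \<le> 2 * u" using r real by (simp del: ennreal_plus)
    then have "?G \<le> 2 * ennreal u" using r real
      by (simp add: numeral_mult_ennreal ennreal_leI)
    then show ?thesis by (simp add: ennreal_mult mult.assoc flip: real(2))
  next
    case top
    have "ennreal (2 * (2 * q / (q - 1)) powr q) * ?F = 2 * (ennreal ((2 * q / (q - 1)) powr q) * ?F)"
      by (simp add: ennreal_mult mult.assoc)
    then show ?thesis using top by (simp add: ennreal_mult_top)
  qed
qed

section \<open>Hoelder's inequality for several functions\<close>

lemma weighted_arith_geo_mean:
  fixes x \<theta> :: "'i \<Rightarrow> real"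
  assumes "finite I" "\<And>i. i \<in> I \<Longrightarrow> 0 < \<theta> i" "(\<Sum>i\<in>I. \<theta> i) = 1" "\<And>i. i \<in> I \<Longrightarrow> 0 \<le> x i"
  shows "(\<Prod>i\<in>I. x i powr \<theta> i) \<le> (\<Sum>i\<in>I. \<theta> i * x i)"
proof (cases "\<exists>i\<in>I. x i = 0")
  case True
  then have "(\<Prod>i\<in>I. x i powr \<theta> i) = 0" using assms(1) by (auto simp: prod_zero_iff)
  moreover have "0 \<le> (\<Sum>i\<in>I. \<theta> i * x i)"
    using assms by (intro sum_nonneg mult_nonneg_nonneg) (auto intro: less_imp_le)
  ultimately show ?thesis by simp
next
  case False
  then have pos: "\<And>i. i \<in> I \<Longrightarrow> 0 < x i" using assms(4) by (metis less_eq_real_def)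
  have "(\<Prod>i\<in>I. x i powr \<theta> i) = exp (\<Sum>i\<in>I. \<theta> i *\<^sub>R ln (x i))"
    using assms(1) by (auto simp: exp_sum powr_def intro!: prod.cong dest: pos)
  also have "\<dots> \<le> (\<Sum>i\<in>I. \<theta> i * exp (ln (x i)))"
    using assms by (intro convex_on_sum[of I UNIV exp] exp_convex) (auto intro: less_imp_le)
  finally show ?thesis using pos by simp
qed

lemma weighted_arith_geo_mean_ennreal:
  fixes y :: "'i \<Rightarrow> ennreal"
  assumes "finite I" "\<And>i. i \<in> I \<Longrightarrow> 0 < \<theta> i" "(\<Sum>i\<in>I. \<theta> i) = 1"
  shows "(\<Prod>i\<in>I. epowr (y i) (\<theta> i)) \<le> (\<Sum>i\<in>I. ennreal (\<theta> i) * y i)"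
proof (cases "\<exists>i\<in>I. y i = top")
  case True
  then obtain i where "i \<in> I" "ennreal (\<theta> i) * y i = top"
    using assms(2) by (auto simp: ennreal_mult_top ennreal_eq_0_iff not_le)
  then have "(\<Sum>i\<in>I. ennreal (\<theta> i) * y i) = top"
    using assms(1) by (auto simp: ennreal_sum_eq_top)
  then show ?thesis by simp
next
  case False
  then have y: "y i = ennreal (enn2real (y i))" if "i \<in> I" for i
    using that by (simp add: less_top)
  have "(\<Prod>i\<in>I. epowr (y i) (\<theta> i)) = ennreal (\<Prod>i\<in>I. enn2real (y i) powr \<theta> i)"
    using False by (auto simp: epowr_def prod_ennreal[symmetric] intro!: prod.cong)
  also have "\<dots> \<le> ennreal (\<Sum>i\<in>I. \<theta> i * enn2real (y i))"
    using assms by (intro ennreal_leI weighted_arith_geo_mean) auto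
  also have "\<dots> = (\<Sum>i\<in>I. ennreal (\<theta> i) * y i)"
    using assms(2) y by (subst sum_ennreal[symmetric])
      (auto intro!: sum.cong mult_nonneg_nonneg simp: less_imp_le ennreal_mult)
  finally show ?thesis .
qed

text \<open>Normalising each function by its integral reduces the claim to the weighted inequality between
the geometric and the arithmetic mean, integrated. The normalisation is impossible when an
integral is \<open>0\<close> or \<open>\<infinity>\<close>; these cases are degenerate, where \<open>0\<close> takes precedence over \<open>\<infinity>\<close>.\<close>

lemma Hoelder_nn_integral_prod:
  fixes h :: "'i \<Rightarrow> 'a \<Rightarrow> ennreal"
  assumes I: "finite I" "\<And>i. i \<in> I \<Longrightarrow> 0 < \<theta> i" "(\<Sum>i\<in>I. \<theta> i) = 1"
    and meas [measurable]: "\<And>i. i \<in> I \<Longrightarrow> h i \<in> borel_measurable M"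
  shows "(\<integral>\<^sup>+x. (\<Prod>i\<in>I. epowr (h i x) (\<theta> i)) \<partial>M) \<le> (\<Prod>i\<in>I. epowr (\<integral>\<^sup>+x. h i x \<partial>M) (\<theta> i))"
    (is "_ \<le> (\<Prod>i\<in>I. epowr (?J i) (\<theta> i))")
proof -
  consider (zero) i where "i \<in> I" "?J i = 0"
    | (top) i where "i \<in> I" "?J i = top" "\<And>i. i \<in> I \<Longrightarrow> ?J i \<noteq> 0"
    | (fin) "\<And>i. i \<in> I \<Longrightarrow> 0 < ?J i \<and> ?J i < top"
    by (metis less_top zero_less_iff_neq_zero)
  then show ?thesis
  proof cases
    case zero
    then have "AE x in M. h i x = 0" by (simp add: nn_integral_0_iff_AE)
    then have "AE x in M. (\<Prod>i\<in>I. epowr (h i x) (\<theta> i)) = 0"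
    proof eventually_elim
      case (elim x)
      then show ?case using I zero(1) by (auto intro!: bexI[of _ i])
    qed
    then have "(\<integral>\<^sup>+x. (\<Prod>i\<in>I. epowr (h i x) (\<theta> i)) \<partial>M) = (\<integral>\<^sup>+x. 0 \<partial>M)"
      by (rule nn_integral_cong_AE)
    then show ?thesis by simp
  next
    case top
    then have "(\<Prod>i\<in>I. epowr (?J i) (\<theta> i)) = top"
      using I by (auto simp: ennreal_prod_eq_top)
    then show ?thesis by simp
  next
    case fin
    define c where "c = (\<Prod>i\<in>I. epowr (?J i) (\<theta> i))"
    have "(\<Prod>i\<in>I. epowr (h i x) (\<theta> i)) \<le> c * (\<Sum>i\<in>I. ennreal (\<theta> i) * (h i x / ?J i))" for x
    proof -
      have "h i x = ?J i * (h i x / ?J i)" if "i \<in> I" for i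
        using fin[OF that]
        by (metis ennreal_times_divide less_irrefl mult.commute mult_divide_eq_ennreal)
      then have "(\<Prod>i\<in>I. epowr (h i x) (\<theta> i)) = (\<Prod>i\<in>I. epowr (?J i) (\<theta> i) * epowr (h i x / ?J i) (\<theta> i))"
        by (metis (no_types, lifting) epowr_mult prod.cong)
      also have "\<dots> = c * (\<Prod>i\<in>I. epowr (h i x / ?J i) (\<theta> i))"
        by (simp add: prod.distrib c_def)
      also have "\<dots> \<le> c * (\<Sum>i\<in>I. ennreal (\<theta> i) * (h i x / ?J i))"
        by (intro mult_left_mono weighted_arith_geo_mean_ennreal I) auto
      finally show ?thesis .
    qed
    then have "(\<integral>\<^sup>+x. (\<Prod>i\<in>I. epowr (h i x) (\<theta> i)) \<partial>M)
       \<le> (\<integral>\<^sup>+x. c * (\<Sum>i\<in>I. ennreal (\<theta> i) * (h i x / ?J i)) \<partial>M)"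
      by (rule nn_integral_mono)
    also have "\<dots> = c * (\<Sum>i\<in>I. ennreal (\<theta> i) * (?J i / ?J i))"
      by (subst nn_integral_cmult) (auto simp: nn_integral_sum nn_integral_cmult nn_integral_divide)
    also have "(\<Sum>i\<in>I. ennreal (\<theta> i) * (?J i / ?J i)) = (\<Sum>i\<in>I. ennreal (\<theta> i))"
      using fin by (intro sum.cong refl) (simp add: zero_less_iff_neq_zero)
    also have "\<dots> = 1" using I by (simp add: less_imp_le)
    finally show ?thesis by (simp add: c_def)
  qed
qed

section \<open>Maximal functions of finite laminar families\<close>

definition laminar :: "'a set set \<Rightarrow> bool"
  where "laminar F \<longleftrightarrow> (\<forall>A\<in>F. \<forall>B\<in>F. A \<inter> B = {} \<or> A \<subseteq> B \<or> B \<subseteq> A)"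

text \<open>The supremum of \<open>b Q\<close> over the members \<open>Q\<close> that contain \<open>x\<close>, written with indicators so that it
is a supremum of simple functions and hence measurable for countable \<open>F\<close>.\<close>

definition family_max :: "'a set set \<Rightarrow> ('a set \<Rightarrow> ennreal) \<Rightarrow> 'a \<Rightarrow> ennreal"
  where "family_max F b x = (SUP Q\<in>F. b Q * indicator Q x)"

lemma laminar_subset: "laminar F \<Longrightarrow> G \<subseteq> F \<Longrightarrow> laminar G"
  by (auto simp: laminar_def)

lemma laminar_maximal_members:
  assumes "finite G" "laminar G"
  obtains H where "H \<subseteq> G" "disjoint H" "\<And>Q. Q \<in> G \<Longrightarrow> \<exists>R\<in>H. Q \<subseteq> R"
proof
  define H where "H = {R \<in> G. \<forall>R'\<in>G. R \<subseteq> R' \<longrightarrow> R = R'}"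
  show "H \<subseteq> G" by (auto simp: H_def)
  show "disjoint H"
  proof (unfold disjoint_def, intro ballI impI)
    fix A B assume AB: "A \<in> H" "B \<in> H" "A \<noteq> B"
    then have "A \<in> G" "B \<in> G" by (auto simp: H_def)
    with assms(2) have "A \<inter> B = {} \<or> A \<subseteq> B \<or> B \<subseteq> A" unfolding laminar_def by blast
    with AB show "A \<inter> B = {}" unfolding H_def by blast
  qed
  show "\<exists>R\<in>H. Q \<subseteq> R" if "Q \<in> G" for Q
    using finite_has_maximal2[OF assms(1) that] by (auto simp: H_def)
qed

lemma family_max_upper: "Q \<in> F \<Longrightarrow> x \<in> Q \<Longrightarrow> b Q \<le> family_max F b x"
  unfolding family_max_def by (rule SUP_upper2[of Q]) auto

lemma family_max_least: "(\<And>Q. Q \<in> F \<Longrightarrow> x \<in> Q \<Longrightarrow> b Q \<le> c) \<Longrightarrow> family_max F b x \<le> c"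
  unfolding family_max_def by (rule SUP_least) (auto split: split_indicator)

lemma less_family_max_iff: "t < family_max F b x \<longleftrightarrow> (\<exists>Q\<in>F. x \<in> Q \<and> t < b Q)"
  unfolding family_max_def less_SUP_iff by (auto simp: indicator_def)

lemma superlevel_family_max: "{x. t < family_max F b x} = \<Union>{Q \<in> F. t < b Q}"
  by (auto simp: less_family_max_iff)

lemma borel_measurable_family_max:
  assumes "countable F" "F \<subseteq> sets M"
  shows "family_max F b \<in> borel_measurable M"
  unfolding family_max_def[abs_def] using assms
  by (intro borel_measurable_SUP borel_measurable_times_ennreal borel_measurable_indicator) auto

lemma epowr_family_max:
  assumes "0 < a"
  shows "epowr (family_max F b x) a = family_max F (\<lambda>Q. epowr (b Q) a) x"
  unfolding family_max_def epowr_SUP[OF assms]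
  by (intro SUP_cong refl) (simp add: indicator_def)

lemma nn_integral_Union_disjoint:
  assumes "finite H" "disjoint H" "H \<subseteq> sets M" and [measurable]: "u \<in> borel_measurable M"
  shows "(\<integral>\<^sup>+x. u x * indicator (\<Union>H) x \<partial>M) = (\<Sum>R\<in>H. \<integral>\<^sup>+x. u x * indicator R x \<partial>M)"
proof -
  have "indicator (\<Union>H) x = (\<Sum>R\<in>H. indicator R x :: ennreal)" for x
  proof (cases "\<exists>R\<in>H. x \<in> R")
    case True
    then obtain R where R: "R \<in> H" "x \<in> R" by auto
    then have "(\<Sum>R\<in>H. indicator R x :: ennreal) = (\<Sum>R'\<in>{R}. indicator R' x)"
      using assms(1,2) by (intro sum.mono_neutral_right) (auto simp: disjoint_def indicator_def)
    moreover have "x \<in> \<Union>H" using R by auto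
    ultimately show ?thesis using R by simp
  qed (auto simp: indicator_def)
  then have "(\<integral>\<^sup>+x. u x * indicator (\<Union>H) x \<partial>M) = (\<integral>\<^sup>+x. (\<Sum>R\<in>H. u x * indicator R x) \<partial>M)"
    by (simp add: sum_distrib_left)
  also have "\<dots> = (\<Sum>R\<in>H. \<integral>\<^sup>+x. u x * indicator R x \<partial>M)"
    using assms by (intro nn_integral_sum borel_measurable_times_ennreal borel_measurable_indicator) auto
  finally show ?thesis .
qed

text \<open>A superlevel set of the maximal function is a union of members of the family, and in a finite
laminar family the maximal ones among these are disjoint. Integrals over superlevel sets therefore
split into sums over single members.\<close>

lemma superlevel_family_max_disjoint:
  assumes "finite F" "laminar F"
  obtains H where "finite H" "disjoint H" "H \<subseteq> {Q \<in> F. t < b Q}"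
    "{x. t < family_max F b x} = \<Union>H" "\<And>Q. Q \<in> F \<Longrightarrow> t < b Q \<Longrightarrow> \<exists>R\<in>H. Q \<subseteq> R"
proof -
  have "finite {Q \<in> F. t < b Q}" "laminar {Q \<in> F. t < b Q}"
    using assms by (auto intro: laminar_subset)
  then obtain H where H: "H \<subseteq> {Q \<in> F. t < b Q}" "disjoint H"
    "\<And>Q. Q \<in> {Q \<in> F. t < b Q} \<Longrightarrow> \<exists>R\<in>H. Q \<subseteq> R"
    using laminar_maximal_members by blast
  show ?thesis
  proof (rule that)
    show "{x. t < family_max F b x} = \<Union>H"
      using H unfolding superlevel_family_max by blast
    show "finite H" using H(1) assms(1) by (auto intro: finite_subset)
  qed (use H in auto)
qed

text \<open>The averages are taken with respect to the weight \<open>s\<close> itself, so the weak type estimate has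
constant \<open>1\<close> and holds for every weight: on each of the disjoint maximal members the average
exceeds \<open>t\<close>, and summation gives the estimate on the whole superlevel set.\<close>

lemma (in sigma_finite_measure) laminar_weighted_maximal_bound:
  fixes f s :: "'a \<Rightarrow> ennreal"
  assumes F: "finite F" "laminar F" "F \<subseteq> sets M"
    and meas [measurable]: "f \<in> borel_measurable M" "s \<in> borel_measurable M"
    and q: "1 < q"
    and s: "\<And>Q. Q \<in> F \<Longrightarrow> 0 < (\<integral>\<^sup>+x. s x * indicator Q x \<partial>M) \<and> (\<integral>\<^sup>+x. s x * indicator Q x \<partial>M) < \<infinity>"
    and f: "(\<integral>\<^sup>+x. epowr (f x) q * s x \<partial>M) < \<infinity>"
  defines "A \<equiv> \<lambda>Q. (\<integral>\<^sup>+x. f x * s x * indicator Q x \<partial>M) / (\<integral>\<^sup>+x. s x * indicator Q x \<partial>M)"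
  shows "(\<integral>\<^sup>+x. epowr (family_max F A x) q * s x \<partial>M)
    \<le> ennreal (2 * (2 * q / (q - 1)) powr q) * (\<integral>\<^sup>+x. epowr (f x) q * s x \<partial>M)"
proof (rule strong_type_from_weak_type[OF meas(1) _ meas(2) q])
  have [measurable]: "Q \<in> F \<Longrightarrow> Q \<in> sets M" for Q using F by auto
  show "family_max F A \<in> borel_measurable M"
    using F by (intro borel_measurable_family_max countable_finite)
  fix t :: real
  assume "0 < t"
  obtain H where H: "finite H" "disjoint H" "H \<subseteq> {Q \<in> F. ennreal t < A Q}"
    "{x. ennreal t < family_max F A x} = \<Union>H"
    using superlevel_family_max_disjoint[OF F(1,2)] by metis
  have HM: "H \<subseteq> sets M" using H F by auto
  have "ennreal t * (\<integral>\<^sup>+x. s x * indicator {x. ennreal t < family_max F A x} x \<partial>M)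
    = (\<Sum>R\<in>H. ennreal t * (\<integral>\<^sup>+x. s x * indicator R x \<partial>M))"
    unfolding H(4) using H HM by (simp add: nn_integral_Union_disjoint sum_distrib_left)
  also have "\<dots> \<le> (\<Sum>R\<in>H. \<integral>\<^sup>+x. f x * s x * indicator R x \<partial>M)"
  proof (rule sum_mono)
    fix R assume "R \<in> H"
    then have R: "R \<in> F" "ennreal t < A R" using H by auto
    have "ennreal t * (\<integral>\<^sup>+x. s x * indicator R x \<partial>M) \<le> A R * (\<integral>\<^sup>+x. s x * indicator R x \<partial>M)"
      using R by (intro mult_right_mono) auto
    also have "\<dots> = (\<integral>\<^sup>+x. f x * s x * indicator R x \<partial>M)"
      using s[OF R(1)] unfolding A_def ennreal_divide_times by (simp add: zero_less_iff_neq_zero)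
    finally show "ennreal t * (\<integral>\<^sup>+x. s x * indicator R x \<partial>M) \<le> (\<integral>\<^sup>+x. f x * s x * indicator R x \<partial>M)" .
  qed
  also have "\<dots> = (\<integral>\<^sup>+x. f x * s x * indicator {x. ennreal t < family_max F A x} x \<partial>M)"
    unfolding H(4) using H HM by (simp add: nn_integral_Union_disjoint)
  finally show "ennreal t * (\<integral>\<^sup>+x. s x * indicator {x. ennreal t < family_max F A x} x \<partial>M)
    \<le> (\<integral>\<^sup>+x. f x * s x * indicator {x. ennreal t < family_max F A x} x \<partial>M)" .
next
  have [measurable]: "Q \<in> F \<Longrightarrow> Q \<in> sets M" for Q using F by auto
  have bound: "epowr (family_max F A x) q \<le> (\<Sum>Q\<in>F. epowr (A Q) q * indicator Q x)" for x
  proof -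
    have "epowr (family_max F A x) q = family_max F (\<lambda>Q. epowr (A Q) q) x"
      using q by (intro epowr_family_max) auto
    also have "\<dots> \<le> (\<Sum>Q\<in>F. epowr (A Q) q * indicator Q x)"
      unfolding family_max_def using F by (intro SUP_least member_le_sum) auto
    finally show ?thesis .
  qed
  have "(\<integral>\<^sup>+x. epowr (family_max F A x) q * s x \<partial>M)
    \<le> (\<integral>\<^sup>+x. (\<Sum>Q\<in>F. epowr (A Q) q * (s x * indicator Q x)) \<partial>M)"
  proof (intro nn_integral_mono)
    fix x
    have "epowr (family_max F A x) q * s x \<le> (\<Sum>Q\<in>F. epowr (A Q) q * indicator Q x) * s x"
      by (intro mult_right_mono bound) simp
    also have "\<dots> = (\<Sum>Q\<in>F. epowr (A Q) q * (s x * indicator Q x))"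
      unfolding sum_distrib_right by (intro sum.cong refl) (simp add: mult_ac)
    finally show "epowr (family_max F A x) q * s x \<le> (\<Sum>Q\<in>F. epowr (A Q) q * (s x * indicator Q x))" .
  qed
  also have "\<dots> = (\<Sum>Q\<in>F. epowr (A Q) q * (\<integral>\<^sup>+x. s x * indicator Q x \<partial>M))"
    by (subst nn_integral_sum) (auto intro!: sum.cong nn_integral_cmult)
  also have "\<dots> < \<infinity>"
  proof -
    \<comment> \<open>from \<open>f \<le> 1 + f\<^sup>q\<close>\<close>
    have "A Q < top" if Q: "Q \<in> F" for Q
    proof -
      have "f x \<le> 1 + epowr (f x) q" for x
      proof (cases "f x \<le> 1")
        case False
        then have "epowr (f x) 1 * 1 \<le> epowr (f x) 1 * epowr (f x) (q - 1)"
          using q epowr_mono[of "q - 1" 1 "f x"] by (intro mult_left_mono) auto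
        also have "\<dots> = epowr (f x) q" using epowr_add[of 1 "q - 1" "f x"] q by simp
        finally show ?thesis by (simp add: add_increasing)
      qed (simp add: add_increasing2)
      then have "(\<integral>\<^sup>+x. f x * s x * indicator Q x \<partial>M)
          \<le> (\<integral>\<^sup>+x. (1 + epowr (f x) q) * (s x * indicator Q x) \<partial>M)"
        by (intro nn_integral_mono) (auto simp: mult.assoc intro: mult_right_mono)
      also have "\<dots> = (\<integral>\<^sup>+x. s x * indicator Q x + epowr (f x) q * s x * indicator Q x \<partial>M)"
        by (simp add: distrib_right mult.assoc)
      also have "\<dots> = (\<integral>\<^sup>+x. s x * indicator Q x \<partial>M) + (\<integral>\<^sup>+x. epowr (f x) q * s x * indicator Q x \<partial>M)"
        using Q by (intro nn_integral_add) auto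
      also have "\<dots> < \<infinity>"
      proof -
        have "(\<integral>\<^sup>+x. epowr (f x) q * s x * indicator Q x \<partial>M) \<le> (\<integral>\<^sup>+x. epowr (f x) q * s x \<partial>M)"
          by (intro nn_integral_mono) (auto simp: indicator_def)
        then show ?thesis using f s[OF Q] by (auto intro: le_less_trans)
      qed
      finally show ?thesis
        using s[OF Q] unfolding A_def by (auto simp: ennreal_divide_eq_top_iff less_top[symmetric])
    qed
    then show ?thesis using s F(1) by (auto simp: ennreal_mult_less_top)
  qed
  finally show "(\<integral>\<^sup>+x. epowr (family_max F A x) q * s x \<partial>M) < \<infinity>" .
qed

lemma sum_UN_le:
  fixes l :: "'b \<Rightarrow> ennreal"
  assumes "finite H" "\<And>R. R \<in> H \<Longrightarrow> finite (G R)"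
  shows "sum l (\<Union>R\<in>H. G R) \<le> (\<Sum>R\<in>H. sum l (G R))"
  using assms
proof (induction H)
  case (insert R H)
  have "sum l (G R \<union> (\<Union>R\<in>H. G R)) \<le> sum l (G R \<union> (\<Union>R\<in>H. G R)) + sum l (G R \<inter> (\<Union>R\<in>H. G R))"
    by simp
  also have "\<dots> = sum l (G R) + sum l (\<Union>R\<in>H. G R)"
    using insert by (intro sum.union_inter) auto
  also have "\<dots> \<le> sum l (G R) + (\<Sum>R\<in>H. sum l (G R))"
    using insert by (intro add_left_mono) auto
  finally show ?case using insert by simp
qed simp

text \<open>Both sides are written by the layer cake formula, the left one over the counting measure on the
family. It then suffices to compare, for each \<open>t\<close>, the mass \<open>l\<close> of the members with coefficient
above \<open>t\<close> with the measure, of density \<open>n\<close>, of their union; this is the packing condition on the maximal members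
of that subfamily, which are disjoint.\<close>

lemma (in sigma_finite_measure) laminar_Carleson_embedding:
  assumes F: "finite F" "laminar F" "F \<subseteq> sets M"
    and meas [measurable]: "n \<in> borel_measurable M" and p: "0 < p"
    and Carleson: "\<And>R. R \<in> F \<Longrightarrow> (\<Sum>Q\<in>{Q\<in>F. Q \<subseteq> R}. l Q) \<le> K * (\<integral>\<^sup>+x. n x * indicator R x \<partial>M)"
  shows "(\<Sum>Q\<in>F. epowr (b Q) p * l Q) \<le> K * (\<integral>\<^sup>+x. epowr (family_max F b x) p * n x \<partial>M)"
proof -
  interpret N: sigma_finite_measure "count_space F"
    using F(1) by (intro sigma_finite_measure_count_space_finite)
  have [measurable]: "family_max F b \<in> borel_measurable M"
    using F by (intro borel_measurable_family_max countable_finite)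
  \<comment> \<open>the sum becomes an integral over the counting measure so that the layer cake formula applies\<close>
  have "(\<Sum>Q\<in>F. epowr (b Q) p * l Q) = (\<integral>\<^sup>+Q. epowr (b Q) p * l Q \<partial>count_space F)"
    using F(1) by (simp add: nn_integral_count_space_finite)
  also have "\<dots> = (\<integral>\<^sup>+t. ennreal (p * t powr (p - 1)) * indicator {0<..} t
      * (\<integral>\<^sup>+Q. l Q * indicator {Q. ennreal t < b Q} Q \<partial>count_space F) \<partial>lborel)"
    using p by (intro N.layer_cake[where g = b and h = l]) (simp_all add: measurable_count_space_eq1)
  also have "\<dots> \<le> (\<integral>\<^sup>+t. K * (ennreal (p * t powr (p - 1)) * indicator {0<..} t
      * (\<integral>\<^sup>+x. n x * indicator {x. ennreal t < family_max F b x} x \<partial>M)) \<partial>lborel)"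
  proof (rule nn_integral_mono)
    fix t :: real
    obtain H where H: "finite H" "disjoint H" "H \<subseteq> {Q \<in> F. ennreal t < b Q}"
      "{x. ennreal t < family_max F b x} = \<Union>H"
      "\<And>Q. Q \<in> F \<Longrightarrow> ennreal t < b Q \<Longrightarrow> \<exists>R\<in>H. Q \<subseteq> R"
      by (rule superlevel_family_max_disjoint[OF F(1,2), of "ennreal t" b]) (blast intro: that)
    have "(\<integral>\<^sup>+Q. l Q * indicator {Q. ennreal t < b Q} Q \<partial>count_space F)
       = (\<Sum>Q\<in>{Q\<in>F. ennreal t < b Q}. l Q)"
      unfolding nn_integral_count_space_finite[OF F(1)]
      by (intro sum.mono_neutral_cong_right F(1)) (auto simp: indicator_def)
    also have "\<dots> \<le> (\<Sum>Q\<in>(\<Union>R\<in>H. {Q\<in>F. Q \<subseteq> R}). l Q)"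
      using H(1,5) F(1) by (intro sum_mono2) auto
    also have "\<dots> \<le> (\<Sum>R\<in>H. \<Sum>Q\<in>{Q\<in>F. Q \<subseteq> R}. l Q)"
      using H(1) F(1) by (intro sum_UN_le) auto
    also have "\<dots> \<le> (\<Sum>R\<in>H. K * (\<integral>\<^sup>+x. n x * indicator R x \<partial>M))"
      using H(3) by (intro sum_mono Carleson) auto
    also have "\<dots> = K * (\<integral>\<^sup>+x. n x * indicator {x. ennreal t < family_max F b x} x \<partial>M)"
    proof -
      have "H \<subseteq> sets M" using H F by auto
      then show ?thesis
        unfolding H(4) using H by (simp add: nn_integral_Union_disjoint sum_distrib_left)
    qed
    finally show "ennreal (p * t powr (p - 1)) * indicator {0<..} t
        * (\<integral>\<^sup>+Q. l Q * indicator {Q. ennreal t < b Q} Q \<partial>count_space F)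
      \<le> K * (ennreal (p * t powr (p - 1)) * indicator {0<..} t
        * (\<integral>\<^sup>+x. n x * indicator {x. ennreal t < family_max F b x} x \<partial>M))"
      unfolding mult.left_commute[of K] by (intro mult_left_mono) auto
  qed
  also have "\<dots> = K * (\<integral>\<^sup>+t. ennreal (p * t powr (p - 1)) * indicator {0<..} t
      * (\<integral>\<^sup>+x. n x * indicator {x. ennreal t < family_max F b x} x \<partial>M) \<partial>lborel)"
    by (rule nn_integral_cmult) measurable
  also have "\<dots> = K * (\<integral>\<^sup>+x. epowr (family_max F b x) p * n x \<partial>M)"
    using p by (subst layer_cake) auto
  finally show ?thesis .
qed

lemma family_max_insert:
  "family_max (insert Q F) b x = max (b Q * indicator Q x) (family_max F b x)"
  by (simp add: family_max_def sup_max)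

text \<open>This linearises the maximal function: its integral becomes a sum over the members of the family, in
which ties between members are resolved by the order in which they are added.\<close>

lemma family_max_attained_partition:
  assumes "finite F" "F \<subseteq> sets M"
  obtains E where "\<And>Q. Q \<in> F \<Longrightarrow> E Q \<in> sets M" "\<And>Q. Q \<in> F \<Longrightarrow> E Q \<subseteq> Q"
    "disjoint_family_on E F"
    "\<And>x. x \<in> space M \<Longrightarrow> family_max F a x = 0 \<or> (\<exists>Q\<in>F. x \<in> E Q \<and> family_max F a x = a Q)"
proof -
  have "\<exists>E. (\<forall>Q\<in>F. E Q \<in> sets M \<and> E Q \<subseteq> Q) \<and> disjoint_family_on E F \<and>
     (\<forall>x\<in>space M. family_max F a x = 0 \<or> (\<exists>Q\<in>F. x \<in> E Q \<and> family_max F a x = a Q))"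
    using assms
  proof (induction F)
    case empty
    then show ?case by (auto simp: family_max_def disjoint_family_on_def bot_ennreal)
  next
    case (insert Q F)
    then obtain E where E: "\<forall>Q\<in>F. E Q \<in> sets M \<and> E Q \<subseteq> Q" "disjoint_family_on E F"
     "\<forall>x\<in>space M. family_max F a x = 0 \<or> (\<exists>Q\<in>F. x \<in> E Q \<and> family_max F a x = a Q)"
      by auto
    have [measurable]: "family_max F a \<in> borel_measurable M"
      using insert by (intro borel_measurable_family_max countable_finite) auto
    have [measurable]: "Q \<in> sets M" using insert by auto
    \<comment> \<open>the new member \<open>Q\<close> takes over the points where it does at least as well as all others\<close>
    define D where "D = Q \<inter> {x \<in> space M. family_max F a x \<le> a Q}"
    have D: "D \<in> sets M" "D \<subseteq> Q" by (auto simp: D_def)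
    define E' where "E' = (\<lambda>R. if R = Q then D else E R - D)"
    show ?case
    proof (intro exI[of _ E'] conjI ballI)
      fix R assume "R \<in> insert Q F"
      then show "E' R \<in> sets M" "E' R \<subseteq> R" using D E(1) by (auto simp: E'_def)
    next
      show "disjoint_family_on E' (insert Q F)"
        using E(2) insert.hyps unfolding disjoint_family_on_def E'_def by auto
    next
      fix x assume x: "x \<in> space M"
      show "family_max (insert Q F) a x = 0 \<or> (\<exists>R\<in>insert Q F. x \<in> E' R \<and> family_max (insert Q F) a x = a R)"
      proof (cases "x \<in> D")
        case True
        then show ?thesis by (auto simp: D_def E'_def family_max_insert max_def)
      next
        case False
        then have "family_max (insert Q F) a x = family_max F a x"
          using x by (auto simp: D_def family_max_insert indicator_def max_def)
        moreover have "Q' \<noteq> Q" if "Q' \<in> F" for Q' using that insert.hyps by auto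
        ultimately show ?thesis using E(3) x False unfolding E'_def by (metis DiffI insertI2)
      qed
    qed
  qed
  then show ?thesis using that by blast
qed

text \<open>The coefficient of \<open>Q\<close> factors into \<open>s Q\<close>, which contains only the weights,
and the product of the weighted averages of the \<open>\<phi> i\<close>. After linearisation the integral is
a sum over \<open>Q\<close> of the \<open>p\<close>-th powers of these products, with masses formed from \<open>s Q\<close> and the
\<open>v\<close>-measure of \<open>E Q\<close>. The testing hypothesis says exactly that these masses satisfy the packing condition
with respect to the measure with density \<open>\<Prod>i. \<sigma> i powr (p / P i)\<close>. The Carleson embedding leaves the integral
of a maximal function against this density. Since the exponents \<open>p / P i\<close> add up to \<open>1\<close>, Hoelder's
inequality separates the factors, and each of them is bounded by the weighted maximal inequality.\<close>

lemma (in sigma_finite_measure) laminar_testing_bound: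
  fixes \<sigma> \<phi> :: "'i \<Rightarrow> 'a \<Rightarrow> ennreal"
  assumes F: "finite F" "laminar F" "F \<subseteq> sets M"
    and I: "finite I" "\<And>i. i \<in> I \<Longrightarrow> 1 < P i" "1 / p = (\<Sum>i\<in>I. 1 / P i)" "0 < p"
    and meas [measurable]: "\<And>i. i \<in> I \<Longrightarrow> \<sigma> i \<in> borel_measurable M"
      "\<And>i. i \<in> I \<Longrightarrow> \<phi> i \<in> borel_measurable M" "v \<in> borel_measurable M"
    and \<sigma>: "\<And>i Q. i \<in> I \<Longrightarrow> Q \<in> F \<Longrightarrow>
      0 < (\<integral>\<^sup>+x. \<sigma> i x * indicator Q x \<partial>M) \<and> (\<integral>\<^sup>+x. \<sigma> i x * indicator Q x \<partial>M) < \<infinity>"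
    and \<phi>: "\<And>i. i \<in> I \<Longrightarrow> (\<integral>\<^sup>+x. epowr (\<phi> i x) (P i) * \<sigma> i x \<partial>M) < \<infinity>"
    and testing: "\<And>R. R \<in> F \<Longrightarrow>
      (\<integral>\<^sup>+x. epowr (family_max {Q\<in>F. Q \<subseteq> R} s x) p * v x * indicator R x \<partial>M)
        \<le> K * (\<integral>\<^sup>+x. (\<Prod>i\<in>I. epowr (\<sigma> i x) (p / P i)) * indicator R x \<partial>M)"
  defines "A \<equiv> \<lambda>i Q. (\<integral>\<^sup>+x. \<phi> i x * \<sigma> i x * indicator Q x \<partial>M) / (\<integral>\<^sup>+x. \<sigma> i x * indicator Q x \<partial>M)"
  shows "(\<integral>\<^sup>+x. epowr (family_max F (\<lambda>Q. s Q * (\<Prod>i\<in>I. A i Q)) x) p * v x \<partial>M)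
    \<le> K * (\<Prod>i\<in>I. epowr (ennreal (2 * (2 * P i / (P i - 1)) powr P i)
        * (\<integral>\<^sup>+x. epowr (\<phi> i x) (P i) * \<sigma> i x \<partial>M)) (p / P i))"
proof -
  have FM [measurable]: "Q \<in> F \<Longrightarrow> Q \<in> sets M" for Q using F by auto
  define b where "b = (\<lambda>Q. \<Prod>i\<in>I. A i Q)"
  define a where "a = (\<lambda>Q. s Q * b Q)"
  obtain E where E: "\<And>Q. Q \<in> F \<Longrightarrow> E Q \<in> sets M" "\<And>Q. Q \<in> F \<Longrightarrow> E Q \<subseteq> Q"
    "disjoint_family_on E F"
    "\<And>x. x \<in> space M \<Longrightarrow> family_max F a x = 0 \<or> (\<exists>Q\<in>F. x \<in> E Q \<and> family_max F a x = a Q)"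
    using family_max_attained_partition[OF F(1,3)] by metis
  note E(1)[measurable]
  define l where "l = (\<lambda>Q. epowr (s Q) p * (\<integral>\<^sup>+x. v x * indicator (E Q) x \<partial>M))"
  have "(\<integral>\<^sup>+x. epowr (family_max F a x) p * v x \<partial>M)
     \<le> (\<integral>\<^sup>+x. (\<Sum>Q\<in>F. epowr (a Q) p * (v x * indicator (E Q) x)) \<partial>M)"
  proof (rule nn_integral_mono)
    fix x assume "x \<in> space M"
    from E(4)[OF this] show "epowr (family_max F a x) p * v x
        \<le> (\<Sum>Q\<in>F. epowr (a Q) p * (v x * indicator (E Q) x))"
    proof (elim disjE bexE conjE)
      fix Q assume Q: "Q \<in> F" "x \<in> E Q" "family_max F a x = a Q"
      then have "epowr (family_max F a x) p * v x = epowr (a Q) p * (v x * indicator (E Q) x)" by simp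
      also have "\<dots> \<le> (\<Sum>Q\<in>F. epowr (a Q) p * (v x * indicator (E Q) x))"
        using Q F by (intro member_le_sum) auto
      finally show ?thesis .
    qed simp
  qed
  also have "\<dots> = (\<Sum>Q\<in>F. epowr (a Q) p * (\<integral>\<^sup>+x. v x * indicator (E Q) x \<partial>M))"
    by (subst nn_integral_sum) (auto intro!: sum.cong nn_integral_cmult)
  also have "\<dots> = (\<Sum>Q\<in>F. epowr (b Q) p * l Q)"
    by (simp add: a_def l_def epowr_mult mult_ac)
  also have "\<dots> \<le> K * (\<integral>\<^sup>+x. epowr (family_max F b x) p * (\<Prod>i\<in>I. epowr (\<sigma> i x) (p / P i)) \<partial>M)"
  proof (rule laminar_Carleson_embedding[OF F _ I(4)])
    show "(\<lambda>x. \<Prod>i\<in>I. epowr (\<sigma> i x) (p / P i)) \<in> borel_measurable M" by measurable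
    fix R assume R: "R \<in> F"
    have "(\<Sum>Q\<in>{Q\<in>F. Q \<subseteq> R}. l Q)
      = (\<integral>\<^sup>+x. (\<Sum>Q\<in>{Q\<in>F. Q \<subseteq> R}. epowr (s Q) p * (v x * indicator (E Q) x)) \<partial>M)"
      unfolding l_def by (subst nn_integral_sum) (auto intro!: sum.cong nn_integral_cmult[symmetric])
    also have "\<dots> \<le> (\<integral>\<^sup>+x. epowr (family_max {Q\<in>F. Q \<subseteq> R} s x) p * v x * indicator R x \<partial>M)"
    proof (rule nn_integral_mono)
      fix x
      show "(\<Sum>Q\<in>{Q\<in>F. Q \<subseteq> R}. epowr (s Q) p * (v x * indicator (E Q) x))
          \<le> epowr (family_max {Q\<in>F. Q \<subseteq> R} s x) p * v x * indicator R x"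
      proof (cases "\<exists>Q\<in>{Q\<in>F. Q \<subseteq> R}. x \<in> E Q")
        case True
        then obtain Q where Q: "Q \<in> F" "Q \<subseteq> R" "x \<in> E Q" by auto
        then have "(\<Sum>Q\<in>{Q\<in>F. Q \<subseteq> R}. epowr (s Q) p * (v x * indicator (E Q) x))
          = (\<Sum>Q\<in>{Q}. epowr (s Q) p * (v x * indicator (E Q) x))"
          using F(1) E(3) by (intro sum.mono_neutral_right) (auto simp: disjoint_family_on_def indicator_def)
        also have "\<dots> = epowr (s Q) p * v x" using Q by simp
        also have "\<dots> \<le> epowr (family_max {Q\<in>F. Q \<subseteq> R} s x) p * v x"
          using Q E(2) I(4) by (intro mult_right_mono epowr_mono family_max_upper) auto
        finally show ?thesis using Q E(2) by (force simp: indicator_def)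
      qed (auto simp: indicator_def)
    qed
    also have "\<dots> \<le> K * (\<integral>\<^sup>+x. (\<Prod>i\<in>I. epowr (\<sigma> i x) (p / P i)) * indicator R x \<partial>M)"
      by (rule testing[OF R])
    finally show "(\<Sum>Q\<in>{Q\<in>F. Q \<subseteq> R}. l Q) \<le> K * (\<integral>\<^sup>+x. (\<Prod>i\<in>I. epowr (\<sigma> i x) (p / P i)) * indicator R x \<partial>M)" .
  qed
  also have "\<dots> \<le> K * (\<integral>\<^sup>+x. (\<Prod>i\<in>I. epowr (epowr (family_max F (A i) x) (P i) * \<sigma> i x) (p / P i)) \<partial>M)"
  proof (intro mult_left_mono nn_integral_mono)
    fix x
    have "family_max F b x \<le> (\<Prod>i\<in>I. family_max F (A i) x)"
      unfolding b_def by (intro family_max_least prod_mono_ennreal family_max_upper) auto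
    then have "epowr (family_max F b x) p \<le> (\<Prod>i\<in>I. epowr (family_max F (A i) x) p)"
      using I(4) by (auto simp flip: epowr_prod intro: epowr_mono)
    also have "\<dots> = (\<Prod>i\<in>I. epowr (epowr (family_max F (A i) x) (P i)) (p / P i))"
      using I(2) by (intro prod.cong) (force simp: epowr_epowr)+
    finally show "epowr (family_max F b x) p * (\<Prod>i\<in>I. epowr (\<sigma> i x) (p / P i))
      \<le> (\<Prod>i\<in>I. epowr (epowr (family_max F (A i) x) (P i) * \<sigma> i x) (p / P i))"
      unfolding epowr_mult prod.distrib by (intro mult_right_mono) auto
  qed simp
  also have "\<dots> \<le> K * (\<Prod>i\<in>I. epowr (\<integral>\<^sup>+x. epowr (family_max F (A i) x) (P i) * \<sigma> i x \<partial>M) (p / P i))"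
  proof (intro mult_left_mono Hoelder_nn_integral_prod I(1))
    show "0 < p / P i" if "i \<in> I" for i using I(2)[OF that] I(4) by simp
    show "(\<Sum>i\<in>I. p / P i) = 1"
    proof -
      have "(\<Sum>i\<in>I. p / P i) = p * (1 / p)"
        unfolding I(3) by (simp add: sum_distrib_left)
      then show ?thesis using I(4) by simp
    qed
    have "family_max F (A i) \<in> borel_measurable M" for i
      using F by (intro borel_measurable_family_max countable_finite)
    note this[measurable]
    show "(\<lambda>x. epowr (family_max F (A i) x) (P i) * \<sigma> i x) \<in> borel_measurable M" if "i \<in> I" for i
      using that by measurable
  qed simp
  also have "\<dots> \<le> K * (\<Prod>i\<in>I. epowr (ennreal (2 * (2 * P i / (P i - 1)) powr P i)
        * (\<integral>\<^sup>+x. epowr (\<phi> i x) (P i) * \<sigma> i x \<partial>M)) (p / P i))"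
  proof (intro mult_left_mono prod_mono_ennreal epowr_mono)
    fix i assume i: "i \<in> I"
    show "0 \<le> p / P i" using I(2)[OF i] I(4) by simp
    show "(\<integral>\<^sup>+x. epowr (family_max F (A i) x) (P i) * \<sigma> i x \<partial>M)
      \<le> ennreal (2 * (2 * P i / (P i - 1)) powr P i) * (\<integral>\<^sup>+x. epowr (\<phi> i x) (P i) * \<sigma> i x \<partial>M)"
      unfolding A_def using i by (intro laminar_weighted_maximal_bound F meas I(2) \<sigma> \<phi>)
  qed simp
  finally show ?thesis by (simp add: a_def b_def)
qed

section \<open>Dyadic grids\<close>

lemma sigma_finite_lebesgue: "sigma_finite_measure (lebesgue :: 'a :: euclidean_space measure)"
proof
  show "\<exists>A::'a set set. countable A \<and> A \<subseteq> sets lebesgue \<and> \<Union>A = space lebesgue \<and>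
      (\<forall>a\<in>A. emeasure lebesgue a \<noteq> \<infinity>)"
  proof (intro exI conjI)
    show "countable (range (\<lambda>n::nat. cball (0::'a) (real n)))" by simp
    show "\<Union> (range (\<lambda>n::nat. cball (0::'a) (real n))) = space lebesgue"
      by (auto simp: real_arch_simple)
    show "\<forall>a\<in>range (\<lambda>n::nat. cball (0::'a) (real n)). emeasure lebesgue a \<noteq> \<infinity>"
    proof safe
      fix n :: nat
      assume "emeasure lebesgue (cball (0::'a) (real n)) = \<infinity>"
      moreover have "emeasure lborel (cball (0::'a) (real n)) < \<infinity>"
        by (rule emeasure_bounded_finite) simp
      ultimately show False by simp
    qed
  qed auto
qed

text \<open>The half-open cube with corner \<open>t + s j\<close> and side length \<open>s\<close>. Describing it by floors makes cells of
the same size disjoint by definition and reduces nestedness to the division of integers.\<close>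

definition grid_cell :: "real ^ 'n \<Rightarrow> real \<Rightarrow> ('n \<Rightarrow> int) \<Rightarrow> (real ^ 'n) set"
  where "grid_cell t s j = {y. \<forall>i. \<lfloor>(y $ i - t $ i) / s\<rfloor> = j i}"

text \<open>Only side lengths up to \<open>2 ^ N\<close> occur. Because there is a largest one, a single translation vector serves
all scales in the one-third trick below, and translated cells are nested like untranslated ones. Arbitrarily large cubes are reached as \<open>N\<close> tends to
infinity.\<close>

definition dyadic_grid :: "nat \<Rightarrow> real ^ 'n \<Rightarrow> (real ^ 'n) set set"
  where "dyadic_grid N t = (\<lambda>(k, j). grid_cell t (2 ^ N / 2 ^ k) j) ` (UNIV :: (nat \<times> ('n \<Rightarrow> int)) set)"

text \<open>The set \<open>S\<close> collects the coordinates in which the grid is translated by a third of its largest side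
length, so there are \<open>2\<^sup>n\<close> grids in dimension \<open>n\<close>.\<close>

definition third_shift :: "nat \<Rightarrow> 'n set \<Rightarrow> real ^ 'n"
  where "third_shift N S = (\<chi> i. if i \<in> S then 2 ^ N / 3 else 0)"

lemma countable_dyadic_grid: "countable (dyadic_grid N t)"
  unfolding dyadic_grid_def by (intro countable_image) auto

lemma mem_grid_cell_iff:
  assumes "0 < s"
  shows "y \<in> grid_cell t s j \<longleftrightarrow> (\<forall>i. t $ i + s * j i \<le> y $ i \<and> y $ i < t $ i + s * j i + s)"
proof -
  have "\<lfloor>(y $ i - t $ i) / s\<rfloor> = j i \<longleftrightarrow> t $ i + s * j i \<le> y $ i \<and> y $ i < t $ i + s * j i + s" for i
    using assms by (auto simp: floor_eq_iff field_simps)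
  then show ?thesis by (simp add: grid_cell_def)
qed

lemma emeasure_cube:
  assumes "0 < l"
  shows "emeasure lebesgue (cbox a (a + (\<chi> i. l)) :: (real ^ 'n) set) = ennreal (l ^ CARD('n))"
proof -
  have "cbox a (a + (\<chi> i. l)) \<noteq> {}"
    using assms by (auto simp: interval_eq_empty_cart not_less)
  then have "measure lborel (cbox a (a + (\<chi> i. l))) = l ^ CARD('n)"
    by (subst content_cbox_cart) auto
  then show ?thesis
    using emeasure_lborel_cbox_finite[of a "a + (\<chi> i. l)"]
    by (simp add: emeasure_eq_ennreal_measure)
qed

text \<open>Cells are half-open whereas the cubes in the definition of the maximal function are closed. Passing
to the closure changes a cell only by a null set, and it preserves inclusions.\<close>

lemma grid_cell_closure:
  fixes t :: "real ^ 'n"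
  assumes s: "0 < s"
  shows "closure (grid_cell t s j) = cbox (t + (\<chi> i. s * j i)) (t + (\<chi> i. s * j i) + (\<chi> i. s))" (is "_ = cbox ?a ?b")
    and "closure (grid_cell t s j) - grid_cell t s j \<in> null_sets lebesgue"
proof -
  have ne: "box ?a ?b \<noteq> {}" using s by (auto simp: interval_eq_empty_cart not_le)
  have sub: "box ?a ?b \<subseteq> grid_cell t s j" "grid_cell t s j \<subseteq> cbox ?a ?b"
    using s by (auto simp: mem_grid_cell_iff mem_box_cart less_imp_le)
  show eq: "closure (grid_cell t s j) = cbox ?a ?b"
    using closure_mono[OF sub(1)] closure_minimal[OF sub(2)] ne by (simp add: closed_cbox)
  have "negligible (cbox ?a ?b - grid_cell t s j)"
    by (rule negligible_subset[OF negligible_frontier_interval[of ?a ?b]]) (use sub in auto)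
  then show "closure (grid_cell t s j) - grid_cell t s j \<in> null_sets lebesgue"
    unfolding eq by (simp add: negligible_iff_null_sets)
qed

lemma dyadic_grid_cases:
  assumes "Q \<in> dyadic_grid N t"
  obtains k j where "Q = grid_cell t (2 ^ N / 2 ^ k) j"
  using assms unfolding dyadic_grid_def by auto

lemma dyadic_grid_cell:
  fixes Q :: "(real ^ 'n) set"
  assumes "Q \<in> dyadic_grid N t"
  shows "closure Q \<in> cubes" "closure Q - Q \<in> null_sets lebesgue" "Q \<in> sets lebesgue"
    "emeasure lebesgue (closure Q) = emeasure lebesgue Q"
proof -
  obtain k j where Q: "Q = grid_cell t (2 ^ N / 2 ^ k) j" using assms by (rule dyadic_grid_cases)
  have s: "0 < (2 ^ N / 2 ^ k :: real)" by simp
  show "closure Q \<in> cubes"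
    unfolding Q grid_cell_closure(1)[OF s] cubes_def using s by blast
  show null: "closure Q - Q \<in> null_sets lebesgue"
    unfolding Q by (rule grid_cell_closure(2)[OF s])
  have Q_eq: "Q = closure Q - (closure Q - Q)" using closure_subset by auto
  have "closure Q \<in> sets lebesgue" by simp
  then show "Q \<in> sets lebesgue"
    using null by (subst Q_eq) (auto intro: sets.Diff)
  show "emeasure lebesgue (closure Q) = emeasure lebesgue Q"
    using emeasure_Diff_null_set[OF null, of "closure Q"] Q_eq by simp
qed

lemma laminar_dyadic_grid: "laminar (dyadic_grid N (t :: real ^ 'n))"
proof -
  have nested: "grid_cell t (2 ^ N / 2 ^ k') j' \<subseteq> grid_cell t (2 ^ N / 2 ^ k) j"
    if "k \<le> k'" "z \<in> grid_cell t (2 ^ N / 2 ^ k) j" "z \<in> grid_cell t (2 ^ N / 2 ^ k') j'"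
    for k k' j j' and z :: "real ^ 'n"
  proof -
    have coarse: "\<lfloor>u / (2 ^ N / 2 ^ k)\<rfloor> = \<lfloor>u / (2 ^ N / 2 ^ k')\<rfloor> div 2 ^ (k' - k)" for u :: real
    proof -
      have eq: "u / (2 ^ N / 2 ^ k) = (u / (2 ^ N / 2 ^ k')) / real_of_int (2 ^ (k' - k))"
        using that(1) by (simp add: field_simps flip: power_add)
      show ?thesis unfolding eq by (rule floor_divide_real_eq_div) simp
    qed
    show ?thesis
    proof
      fix y assume "y \<in> grid_cell t (2 ^ N / 2 ^ k') j'"
      then have fine: "\<lfloor>(y $ i - t $ i) / (2 ^ N / 2 ^ k')\<rfloor> = \<lfloor>(z $ i - t $ i) / (2 ^ N / 2 ^ k')\<rfloor>" for i
        using that(3) unfolding grid_cell_def mem_Collect_eq by metis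
      have "\<lfloor>(y $ i - t $ i) / (2 ^ N / 2 ^ k)\<rfloor> = \<lfloor>(z $ i - t $ i) / (2 ^ N / 2 ^ k)\<rfloor>" for i
        by (simp only: coarse fine)
      then show "y \<in> grid_cell t (2 ^ N / 2 ^ k) j"
        using that(2) unfolding grid_cell_def mem_Collect_eq by metis
    qed
  qed
  show ?thesis
    unfolding laminar_def
  proof (intro ballI)
    fix A B assume "A \<in> dyadic_grid N t" "B \<in> dyadic_grid N t"
    then obtain k j k' j' where AB: "A = grid_cell t (2 ^ N / 2 ^ k) j" "B = grid_cell t (2 ^ N / 2 ^ k') j'"
      by (metis dyadic_grid_cases)
    show "A \<inter> B = {} \<or> A \<subseteq> B \<or> B \<subseteq> A"
      using nested[of k k' _ j j'] nested[of k' k _ j' j] unfolding AB by (metis IntE all_not_in_conv linear)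
  qed
qed

text \<open>If both the lattice \<open>s\<int>\<close> and its translate by \<open>2\<^sup>N / 3\<close> separated \<open>x\<close> from \<open>x + l\<close>, they would contain
points at distance less than \<open>l \<le> s / 3\<close>. But \<open>2\<^sup>N / 3\<close> is \<open>2\<^sup>k / 3\<close> times the mesh \<open>s\<close>, and \<open>2\<^sup>k\<close> is not
divisible by \<open>3\<close>, so the points of the two lattices are at least \<open>s / 3\<close> apart.\<close>

lemma floor_eq_or_third_shift_floor_eq:
  fixes x l s :: real
  assumes s: "s = 2 ^ N / 2 ^ k" and l: "0 \<le> l" "3 * l \<le> s"
  shows "\<lfloor>x / s\<rfloor> = \<lfloor>(x + l) / s\<rfloor> \<or> \<lfloor>(x - 2 ^ N / 3) / s\<rfloor> = \<lfloor>(x + l - 2 ^ N / 3) / s\<rfloor>"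
proof (rule ccontr)
  assume neg: "\<not> ?thesis"
  have s0: "0 < s" by (simp add: s)
  define \<alpha> \<beta> c where "\<alpha> = x / s" and "\<beta> = l / s" and "c = (2::real) ^ k / 3"
  have \<beta>: "0 \<le> \<beta>" "3 * \<beta> \<le> 1" using l s0 by (auto simp: \<beta>_def field_simps)
  have c: "(2 ^ N / 3) / s = c" by (simp add: c_def s)
  have jump: "\<exists>u::int. y < u \<and> u \<le> y + \<beta>" if "\<lfloor>y\<rfloor> \<noteq> \<lfloor>y + \<beta>\<rfloor>" for y
  proof -
    have "\<lfloor>y\<rfloor> < \<lfloor>y + \<beta>\<rfloor>" using that \<beta>(1) floor_mono[of y "y + \<beta>"] by simp
    then show ?thesis by (intro exI[of _ "\<lfloor>y + \<beta>\<rfloor>"]) (auto simp: floor_less_iff)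
  qed
  have "\<lfloor>\<alpha>\<rfloor> \<noteq> \<lfloor>\<alpha> + \<beta>\<rfloor>" "\<lfloor>\<alpha> - c\<rfloor> \<noteq> \<lfloor>\<alpha> - c + \<beta>\<rfloor>"
    using neg by (simp_all add: \<alpha>_def \<beta>_def c[symmetric] add_divide_distrib diff_divide_distrib algebra_simps)
  then obtain u w :: int where uw: "\<alpha> < u" "u \<le> \<alpha> + \<beta>" "\<alpha> - c < w" "w \<le> \<alpha> - c + \<beta>"
    using jump by meson
  have "\<bar>3 * (real_of_int u - real_of_int w) - 2 ^ k\<bar> < 1"
  proof -
    \<comment> \<open>two points that lie within \<open>\<beta>\<close> above \<open>\<alpha>\<close> and \<open>\<alpha> - c\<close> differ by \<open>c\<close> up to an error below \<open>1 / 3\<close>\<close>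
    have linear: "\<bar>3 * (U - W) - 3 * c\<bar> < 1"
      if "\<alpha> < U" "U \<le> \<alpha> + \<beta>" "\<alpha> - c < W" "W \<le> \<alpha> - c + \<beta>" for U W :: real
      using that \<beta> by (auto simp: abs_less_iff)
    have "(2::real) ^ k = 3 * c" by (simp add: c_def)
    then show ?thesis using linear[OF uw] by simp
  qed
  then have "\<bar>real_of_int (3 * (u - w) - 2 ^ k)\<bar> < 1" by simp
  then have "3 * (u - w) = 2 ^ k" by linarith
  then have "(3::int) dvd 2 ^ k" by (metis dvd_triv_left)
  moreover have "coprime (3::int) (2 ^ k)" by (simp add: coprime_power_right_iff) 
  ultimately have "is_unit (3::int)" using coprime_absorb_left by blast
  then show False by simp
qed

text \<open>The one-third trick: the translation is chosen separately in each coordinate, and the cell size is the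
smallest admissible one, which is less than \<open>6 l\<close>.\<close>

lemma cube_subset_third_shifted_cell:
  fixes C :: "(real ^ 'n) set"
  assumes C: "C = cbox a (a + (\<chi> i. l))" and l: "0 < l" "3 * l \<le> 2 ^ N"
  shows "\<exists>S. \<exists>R\<in>dyadic_grid N (third_shift N S). C \<subseteq> R \<and>
    emeasure lebesgue R \<le> 6 ^ CARD('n) * emeasure lebesgue C"
proof -
  have "\<exists>k. 2 ^ N / 2 ^ k < 3 * l"
  proof -
    obtain k where "2 ^ N / (3 * l) < 2 ^ k" using real_arch_pow[of 2] by auto
    then show ?thesis using l by (auto simp: field_simps intro!: exI[of _ k])
  qed
  \<comment> \<open>\<open>k0\<close> is the first generation whose cells are too small\<close>
  then obtain k0 where k0: "2 ^ N / 2 ^ k0 < 3 * l" "\<And>k. k < k0 \<Longrightarrow> \<not> 2 ^ N / 2 ^ k < 3 * l"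
    using exists_least_iff[of "\<lambda>k. 2 ^ N / 2 ^ k < 3 * l"] by blast
  have "k0 \<noteq> 0" using k0(1) l(2) by (intro notI) auto
  then obtain k where k: "k0 = Suc k" by (cases k0) auto
  define s :: real where "s = 2 ^ N / 2 ^ k"
  have s0: "0 < s" by (simp add: s_def)
  have s: "3 * l \<le> s" "s < 6 * l"
    using k0(2)[of k] k0(1) by (auto simp: s_def k field_simps)
  \<comment> \<open>translate exactly where the untranslated lattice separates the two faces of the cube\<close>
  define S where "S = {i. \<lfloor>a $ i / s\<rfloor> \<noteq> \<lfloor>(a $ i + l) / s\<rfloor>}"
  define t where "t = third_shift N S"
  define R where "R = grid_cell t s (\<lambda>i. \<lfloor>(a $ i - t $ i) / s\<rfloor>)"
  have eq: "\<lfloor>(a $ i - t $ i) / s\<rfloor> = \<lfloor>(a $ i + l - t $ i) / s\<rfloor>" for i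
    using floor_eq_or_third_shift_floor_eq[OF s_def, of l "a $ i"] l(1) s(1)
    by (auto simp: t_def third_shift_def S_def)
  have "C \<subseteq> R"
  proof
    fix y assume "y \<in> C"
    then have y: "a $ i \<le> y $ i" "y $ i \<le> a $ i + l" for i
      by (auto simp: C mem_box_cart)
    have "\<lfloor>(y $ i - t $ i) / s\<rfloor> = \<lfloor>(a $ i - t $ i) / s\<rfloor>" for i
    proof (rule antisym)
      show "\<lfloor>(y $ i - t $ i) / s\<rfloor> \<le> \<lfloor>(a $ i - t $ i) / s\<rfloor>"
        unfolding eq using y[of i] s0 by (intro floor_mono divide_right_mono) auto
      show "\<lfloor>(a $ i - t $ i) / s\<rfloor> \<le> \<lfloor>(y $ i - t $ i) / s\<rfloor>"
        using y[of i] s0 by (intro floor_mono divide_right_mono) auto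
    qed
    then show "y \<in> R" by (simp add: R_def grid_cell_def)
  qed
  moreover have R: "R \<in> dyadic_grid N t" unfolding R_def dyadic_grid_def s_def by auto
  moreover have "emeasure lebesgue R \<le> 6 ^ CARD('n) * emeasure lebesgue C"
  proof -
    have "emeasure lebesgue R = ennreal (s ^ CARD('n))"
      using dyadic_grid_cell(4)[OF R] unfolding R_def grid_cell_closure(1)[OF s0] emeasure_cube[OF s0] by simp
    also have "\<dots> \<le> ennreal ((6 * l) ^ CARD('n))"
      using s s0 by (intro ennreal_leI power_mono) auto
    also have "\<dots> = 6 ^ CARD('n) * emeasure lebesgue C"
      using l(1) unfolding C emeasure_cube[OF l(1)] 
      by (simp add: power_mult_distrib ennreal_mult flip: ennreal_power)
    finally show ?thesis .
  qed
  ultimately show ?thesis unfolding t_def by blast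
qed

text \<open>Monotone convergence along an enumeration of the family. A grid contains arbitrarily small cells, so
estimates for finite families are transferred to grids by this lemma.\<close>

lemma nn_integral_family_max_countable_le:
  assumes D: "countable D" "D \<subseteq> sets M" and [measurable]: "v \<in> borel_measurable M" and p: "0 < p"
    and le: "\<And>F. finite F \<Longrightarrow> F \<subseteq> D \<Longrightarrow> (\<integral>\<^sup>+x. epowr (family_max F b x) p * v x \<partial>M) \<le> B"
  shows "(\<integral>\<^sup>+x. epowr (family_max D b x) p * v x \<partial>M) \<le> B"
proof (cases "D = {}")
  case False
  define F where "F = (\<lambda>n::nat. from_nat_into D ` {..n})"
  have F: "finite (F n)" "F n \<subseteq> D" for n
    using from_nat_into[OF False] by (auto simp: F_def)
  have UF: "D = (\<Union>n. F n)"
    using D(1) False F(2) by (auto simp: F_def from_nat_into[OF False] dest!: from_nat_into_surj[OF D(1)])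
  have mono: "incseq (\<lambda>n x. epowr (family_max (F n) b x) p * v x)"
    using p by (intro monoI le_funI mult_right_mono epowr_mono)
      (auto simp: family_max_def F_def intro!: SUP_subset_mono)
  have [measurable]: "family_max (F n) b \<in> borel_measurable M" for n
    using F D by (intro borel_measurable_family_max countable_finite) auto
  have "(\<integral>\<^sup>+x. epowr (family_max D b x) p * v x \<partial>M) = (\<integral>\<^sup>+x. (SUP n. epowr (family_max (F n) b x) p * v x) \<partial>M)"
  proof (intro nn_integral_cong)
    fix x
    have "family_max D b x = (SUP n. family_max (F n) b x)"
      unfolding family_max_def UF by (rule SUP_UNION)
    then show "epowr (family_max D b x) p * v x = (SUP n. epowr (family_max (F n) b x) p * v x)"
      using p by (simp add: epowr_SUP SUP_mult_right_ennreal)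
  qed
  also have "\<dots> = (SUP n. \<integral>\<^sup>+x. epowr (family_max (F n) b x) p * v x \<partial>M)"
    by (intro nn_integral_monotone_convergence_SUP mono) measurable
  also have "\<dots> \<le> B" by (intro SUP_least le F)
  finally show ?thesis .
qed (use le[of "{}"] in simp)

section \<open>From the testing condition to the strong type inequality\<close>

definition average_product :: "nat \<Rightarrow> (nat \<Rightarrow> real ^ 'n \<Rightarrow> real) \<Rightarrow> (real ^ 'n) set \<Rightarrow> ennreal"
  where "average_product m g Q = (\<Prod>i\<in>{1..m}. (\<integral>\<^sup>+y\<in>Q. ennreal \<bar>g i y\<bar> \<partial>lebesgue) / emeasure lebesgue Q)"

lemma multi_maximal_eq: "multi_maximal m g x = (SUP Q\<in>{Q \<in> cubes. x \<in> Q}. average_product m g Q)"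
  by (simp add: multi_maximal_def average_product_def)

lemma cubesE:
  assumes "C \<in> cubes"
  obtains a l where "C = cbox a (a + (\<chi> i. l))" "0 < l"
  using assms by (auto simp: cubes_def)

lemma emeasure_cube_finite_pos:
  assumes "C \<in> cubes"
  shows "0 < emeasure lebesgue C" "emeasure lebesgue C < top"
  using assms by (auto simp del: emeasure_completion emeasure_lborel_cbox_eq simp add: emeasure_cube elim!: cubesE)

text \<open>Integrability is assumed only on compact sets; the weight is the pointwise limit of its restrictions to
the balls of integer radius.\<close>

lemma weight_borel_measurable:
  fixes w :: "real ^ 'n \<Rightarrow> real"
  assumes "weight w"
  shows "w \<in> borel_measurable lebesgue"
proof (rule borel_measurable_LIMSEQ_metric)
  fix n :: nat
  have "w absolutely_integrable_on cball 0 (real n)" using assms by (simp add: weight_def)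
  then show "(\<lambda>x. indicator (cball 0 (real n)) x *\<^sub>R w x) \<in> borel_measurable lebesgue"
    unfolding set_integrable_def by (rule borel_measurable_integrable)
next
  fix x :: "real ^ 'n"
  obtain n0 :: nat where "norm x \<le> real n0" using real_arch_simple by blast
  then have "\<forall>\<^sub>F n in sequentially. indicator (cball 0 (real n)) x *\<^sub>R w x = w x"
    by (auto simp: eventually_sequentially intro!: exI[of _ n0])
  then show "(\<lambda>n. indicator (cball 0 (real n)) x *\<^sub>R w x) \<longlonglongrightarrow> w x"
    by (rule tendsto_eventually)
qed

text \<open>These bounds make all the weighted averages and all the quotients in the testing constant genuine
divisions by finite positive numbers.\<close>

lemma weight_measure_cube:
  assumes s: "weight s" and C: "C \<in> cubes"
  shows "0 < weight_measure s C" "weight_measure s C < top"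
proof -
  have [measurable]: "s \<in> borel_measurable lebesgue" using s by (rule weight_borel_measurable)
  have [measurable]: "C \<in> sets lebesgue" using C by (auto elim!: cubesE)
  have "compact C" using C by (auto elim!: cubesE)
  then have int: "integrable lebesgue (\<lambda>x. indicator C x *\<^sub>R s x)"
    using s unfolding weight_def set_integrable_def by blast
  have "weight_measure s C \<le> (\<integral>\<^sup>+x. ennreal (norm (indicator C x *\<^sub>R s x)) \<partial>lebesgue)"
    unfolding weight_measure_def by (intro nn_integral_mono) (auto simp: indicator_def intro!: ennreal_leI)
  also have "\<dots> < top" using int by (simp add: integrable_iff_bounded)
  finally show "weight_measure s C < top" .
  have "weight_measure s C \<noteq> 0"
  proof
    assume "weight_measure s C = 0"
    then have "AE x in lebesgue. ennreal (s x) * indicator C x = 0"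
      unfolding weight_measure_def by (subst (asm) nn_integral_0_iff_AE) auto
    moreover have "AE x in lebesgue. 0 < s x" using s by (simp add: weight_def)
    ultimately have "AE x in lebesgue. x \<notin> C"
      by eventually_elim (auto simp: indicator_def ennreal_eq_0_iff split: if_splits)
    then have "emeasure lebesgue C = 0"
      by (subst (asm) AE_iff_measurable[of C]) auto
    then show False using emeasure_cube_finite_pos[OF C] by simp
  qed
  then show "0 < weight_measure s C" by (simp add: zero_less_iff_neq_zero)
qed

lemma nn_integral_closure_cell:
  assumes "Q \<in> dyadic_grid N t"
  shows "(\<integral>\<^sup>+x\<in>closure Q. u x \<partial>lebesgue) = (\<integral>\<^sup>+x\<in>Q. u x \<partial>lebesgue)"
proof (rule nn_integral_cong_AE)
  show "AE x in lebesgue. u x * indicator (closure Q) x = u x * indicator Q x"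
    using AE_not_in[OF dyadic_grid_cell(2)[OF assms]]
  proof eventually_elim
    case (elim x)
    then show ?case using closure_subset[of Q] by (auto simp: indicator_def)
  qed
qed

lemma weight_measure_cell:
  assumes "weight s" "Q \<in> dyadic_grid N t"
  shows "0 < weight_measure s Q" "weight_measure s Q < top"
proof -
  have "weight_measure s (closure Q) = weight_measure s Q"
    unfolding weight_measure_def by (rule nn_integral_closure_cell[OF assms(2)])
  then show "0 < weight_measure s Q" "weight_measure s Q < top"
    using weight_measure_cube[OF assms(1) dyadic_grid_cell(1)[OF assms(2)]] by auto
qed

text \<open>For a cell \<open>Q\<close> inside \<open>R\<close>, the closure of \<open>Q\<close> is one of the cubes over which the maximal function
of the weights restricted to the closure of \<open>R\<close> takes its supremum.\<close>

lemma cell_testing_maximal_le: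
  fixes \<sigma> :: "nat \<Rightarrow> real ^ 'n \<Rightarrow> real"
  assumes R: "R \<in> dyadic_grid N t" and F: "F \<subseteq> dyadic_grid N t"
  shows "family_max {Q \<in> F. Q \<subseteq> R} (average_product m \<sigma>) x
    \<le> multi_maximal m (\<lambda>i y. \<sigma> i y * indicator (closure R) y) x"
proof (rule family_max_least)
  fix Q assume "Q \<in> {Q \<in> F. Q \<subseteq> R}" and x: "x \<in> Q"
  then have Q: "Q \<in> dyadic_grid N t" "Q \<subseteq> R" using F by auto
  have sub: "closure Q \<subseteq> closure R" using Q(2) by (rule closure_mono)
  have "average_product m \<sigma> Q = average_product m \<sigma> (closure Q)"
    unfolding average_product_def nn_integral_closure_cell[OF Q(1)] dyadic_grid_cell(4)[OF Q(1)] ..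
  also have "\<dots> = average_product m (\<lambda>i y. \<sigma> i y * indicator (closure R) y) (closure Q)"
    unfolding average_product_def using sub
    by (intro prod.cong refl arg_cong2[where f = "(/)"] nn_integral_cong) (auto simp: indicator_def)
  also have "\<dots> \<le> multi_maximal m (\<lambda>i y. \<sigma> i y * indicator (closure R) y) x"
    unfolding multi_maximal_eq using dyadic_grid_cell(1)[OF Q(1)] x closure_subset[of Q]
    by (intro SUP_upper) auto
  finally show "average_product m \<sigma> Q \<le> multi_maximal m (\<lambda>i y. \<sigma> i y * indicator (closure R) y) x" .
qed

text \<open>On a finite part \<open>F\<close> of a grid, the product of the averages of \<open>f i * \<sigma> i\<close> is the product of the averages of
\<open>\<sigma> i\<close> times the product of the \<open>\<sigma> i\<close>-weighted averages of \<open>f i\<close>, which is the form required by the bound for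
laminar families; the testing condition on cells follows from that on their closures.\<close>

lemma dyadic_maximal_bound:
  fixes \<sigma> f :: "nat \<Rightarrow> real ^ 'n \<Rightarrow> real"
  assumes P: "\<And>i. i \<in> {1..m} \<Longrightarrow> 1 < P i" "1 / p = (\<Sum>i\<in>{1..m}. 1 / P i)" "0 < p"
    and \<sigma>: "\<And>i. i \<in> {1..m} \<Longrightarrow> weight (\<sigma> i)" "\<And>i x. 0 \<le> \<sigma> i x"
    and v [measurable]: "v \<in> borel_measurable lebesgue"
    and f: "\<And>i. i \<in> {1..m} \<Longrightarrow> f i \<in> borel_measurable lebesgue"
    and fin: "\<And>i. i \<in> {1..m} \<Longrightarrow>
      (\<integral>\<^sup>+x. epowr (ennreal \<bar>f i x\<bar>) (P i) * ennreal (\<sigma> i x) \<partial>lebesgue) < \<infinity>"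
    and testing: "\<And>C. C \<in> cubes \<Longrightarrow>
      (\<integral>\<^sup>+x\<in>C. epowr (multi_maximal m (\<lambda>i y. \<sigma> i y * indicator C y) x) p * ennreal (v x) \<partial>lebesgue)
        \<le> K * (\<integral>\<^sup>+x\<in>C. (\<Prod>i\<in>{1..m}. ennreal (\<sigma> i x powr (p / P i))) \<partial>lebesgue)"
  shows "(\<integral>\<^sup>+x. epowr (family_max (dyadic_grid N t) (average_product m (\<lambda>i x. f i x * \<sigma> i x)) x) p
      * ennreal (v x) \<partial>lebesgue)
    \<le> K * (\<Prod>i\<in>{1..m}. epowr (ennreal (2 * (2 * P i / (P i - 1)) powr P i)
        * (\<integral>\<^sup>+x. epowr (ennreal \<bar>f i x\<bar>) (P i) * ennreal (\<sigma> i x) \<partial>lebesgue)) (p / P i))"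
proof (rule nn_integral_family_max_countable_le[OF countable_dyadic_grid _ _ P(3)])
  show "dyadic_grid N t \<subseteq> sets lebesgue" using dyadic_grid_cell(3) by auto
  fix F :: "(real ^ 'n) set set"
  assume F: "finite F" "F \<subseteq> dyadic_grid N t"
  interpret sigma_finite_measure "lebesgue :: (real ^ 'n) measure" by (rule sigma_finite_lebesgue)
  have [measurable]: "i \<in> {1..m} \<Longrightarrow> \<sigma> i \<in> borel_measurable lebesgue" for i
    by (intro weight_borel_measurable \<sigma>)
  note f [measurable]
  have powr: "epowr (ennreal (\<sigma> i x)) a = ennreal (\<sigma> i x powr a)" for i x a
    using \<sigma>(2)[of i x] by (simp add: epowr_ennreal max_def)
  have pos: "0 < (\<integral>\<^sup>+x\<in>Q. ennreal (\<sigma> i x) \<partial>lebesgue) \<and> (\<integral>\<^sup>+x\<in>Q. ennreal (\<sigma> i x) \<partial>lebesgue) < \<infinity>"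
    if "i \<in> {1..m}" "Q \<in> F" for i Q
    using weight_measure_cell[OF \<sigma>(1)[OF that(1)]] F(2) that(2) by (auto simp: weight_measure_def)
  have avg: "average_product m (\<lambda>i x. f i x * \<sigma> i x) Q = average_product m \<sigma> Q *
      (\<Prod>i\<in>{1..m}. (\<integral>\<^sup>+x\<in>Q. ennreal \<bar>f i x\<bar> * ennreal (\<sigma> i x) \<partial>lebesgue) / (\<integral>\<^sup>+x\<in>Q. ennreal (\<sigma> i x) \<partial>lebesgue))"
    if Q: "Q \<in> F" for Q
    unfolding average_product_def prod.distrib[symmetric]
  proof (intro prod.cong refl)
    fix i assume i: "i \<in> {1..m}"
    \<comment> \<open>the \<open>\<sigma> i\<close>-measure of \<open>Q\<close> cancels\<close>
    have ne: "(\<integral>\<^sup>+x\<in>Q. ennreal (\<sigma> i x) \<partial>lebesgue) \<noteq> 0" "(\<integral>\<^sup>+x\<in>Q. ennreal (\<sigma> i x) \<partial>lebesgue) \<noteq> top"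
      using pos[OF i Q] by auto
    have "(\<integral>\<^sup>+x\<in>Q. ennreal \<bar>\<sigma> i x\<bar> \<partial>lebesgue) / emeasure lebesgue Q *
        ((\<integral>\<^sup>+x\<in>Q. ennreal \<bar>f i x\<bar> * ennreal (\<sigma> i x) \<partial>lebesgue) / (\<integral>\<^sup>+x\<in>Q. ennreal (\<sigma> i x) \<partial>lebesgue))
      = (\<integral>\<^sup>+x\<in>Q. ennreal \<bar>f i x\<bar> * ennreal (\<sigma> i x) \<partial>lebesgue) / emeasure lebesgue Q *
        ((\<integral>\<^sup>+x\<in>Q. ennreal (\<sigma> i x) \<partial>lebesgue) / (\<integral>\<^sup>+x\<in>Q. ennreal (\<sigma> i x) \<partial>lebesgue))"
      using \<sigma>(2) by (simp add: divide_ennreal_def mult_ac)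
    also have "\<dots> = (\<integral>\<^sup>+x\<in>Q. ennreal \<bar>f i x * \<sigma> i x\<bar> \<partial>lebesgue) / emeasure lebesgue Q"
      using ne \<sigma>(2) by (simp add: less_top abs_mult ennreal_mult)
    finally show "(\<integral>\<^sup>+x\<in>Q. ennreal \<bar>f i x * \<sigma> i x\<bar> \<partial>lebesgue) / emeasure lebesgue Q
      = (\<integral>\<^sup>+x\<in>Q. ennreal \<bar>\<sigma> i x\<bar> \<partial>lebesgue) / emeasure lebesgue Q *
        ((\<integral>\<^sup>+x\<in>Q. ennreal \<bar>f i x\<bar> * ennreal (\<sigma> i x) \<partial>lebesgue) / (\<integral>\<^sup>+x\<in>Q. ennreal (\<sigma> i x) \<partial>lebesgue))"
      by simp
  qed
  have fam: "family_max F (average_product m (\<lambda>i x. f i x * \<sigma> i x)) x = family_max F (\<lambda>Q. average_product m \<sigma> Q *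
      (\<Prod>i\<in>{1..m}. (\<integral>\<^sup>+x\<in>Q. ennreal \<bar>f i x\<bar> * ennreal (\<sigma> i x) \<partial>lebesgue) / (\<integral>\<^sup>+x\<in>Q. ennreal (\<sigma> i x) \<partial>lebesgue))) x" for x
    unfolding family_max_def by (intro SUP_cong refl) (simp add: avg)
  show "(\<integral>\<^sup>+x. epowr (family_max F (average_product m (\<lambda>i x. f i x * \<sigma> i x)) x) p
      * ennreal (v x) \<partial>lebesgue)
    \<le> K * (\<Prod>i\<in>{1..m}. epowr (ennreal (2 * (2 * P i / (P i - 1)) powr P i)
        * (\<integral>\<^sup>+x. epowr (ennreal \<bar>f i x\<bar>) (P i) * ennreal (\<sigma> i x) \<partial>lebesgue)) (p / P i))"
    unfolding fam
  proof (rule laminar_testing_bound[OF F(1) _ _ _ P])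
    show "laminar F" by (rule laminar_subset[OF laminar_dyadic_grid F(2)])
    show "F \<subseteq> sets lebesgue" using F(2) dyadic_grid_cell(3) by auto
    fix R assume R: "R \<in> F"
    then have Rg: "R \<in> dyadic_grid N t" using F(2) by auto
    have "(\<integral>\<^sup>+x\<in>R. epowr (family_max {Q \<in> F. Q \<subseteq> R} (average_product m \<sigma>) x) p * ennreal (v x) \<partial>lebesgue)
      \<le> (\<integral>\<^sup>+x\<in>closure R. epowr (multi_maximal m (\<lambda>i y. \<sigma> i y * indicator (closure R) y) x) p * ennreal (v x) \<partial>lebesgue)"
      using closure_subset[of R] P(3)
      by (intro nn_integral_mono mult_mono epowr_mono cell_testing_maximal_le[OF Rg F(2)])
        (auto simp: indicator_def)
    also have "\<dots> \<le> K * (\<integral>\<^sup>+x\<in>closure R. (\<Prod>i\<in>{1..m}. ennreal (\<sigma> i x powr (p / P i))) \<partial>lebesgue)"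
      by (rule testing[OF dyadic_grid_cell(1)[OF Rg]])
    also have "\<dots> = K * (\<integral>\<^sup>+x\<in>R. (\<Prod>i\<in>{1..m}. epowr (ennreal (\<sigma> i x)) (p / P i)) \<partial>lebesgue)"
      unfolding nn_integral_closure_cell[OF Rg] powr ..
    finally show "(\<integral>\<^sup>+x\<in>R. epowr (family_max {Q \<in> F. Q \<subseteq> R} (average_product m \<sigma>) x) p * ennreal (v x) \<partial>lebesgue)
      \<le> K * (\<integral>\<^sup>+x\<in>R. (\<Prod>i\<in>{1..m}. epowr (ennreal (\<sigma> i x)) (p / P i)) \<partial>lebesgue)" .
  qed (use pos fin in auto)
qed simp

text \<open>The numerators increase when the cube is replaced by the cell of the one-third trick, and each of the
\<open>m\<close> denominators grows by a factor of at most \<open>6\<^sup>n\<close>.\<close>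

lemma average_product_le_dyadic:
  fixes g :: "nat \<Rightarrow> real ^ 'n \<Rightarrow> real"
  assumes C: "C \<in> cubes"
  shows "\<forall>\<^sub>F N in sequentially. \<exists>S. \<forall>x\<in>C. average_product m g C
    \<le> 6 ^ (CARD('n) * m) * family_max (dyadic_grid N (third_shift N S)) (average_product m g) x"
proof -
  obtain a l where C_eq: "C = cbox a (a + (\<chi> i. l))" and l: "0 < l" using C by (rule cubesE)
  obtain N0 where "3 * l < 2 ^ N0" using real_arch_pow[of 2 "3 * l"] by auto
  then have large: "3 * l \<le> 2 ^ N" if "N0 \<le> N" for N
    by (rule order.trans[OF less_imp_le power_increasing[OF that]]) auto
  show ?thesis
    unfolding eventually_sequentially
  proof (intro exI[of _ N0] allI impI)
    fix N assume "N0 \<le> N"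
    then obtain S R where R: "R \<in> dyadic_grid N (third_shift N S)" "C \<subseteq> R"
      "emeasure lebesgue R \<le> 6 ^ CARD('n) * emeasure lebesgue C"
      using cube_subset_third_shifted_cell[OF C_eq l large] by blast
    have Rpos: "0 < emeasure lebesgue R" "emeasure lebesgue R < top"
      using emeasure_cube_finite_pos[OF dyadic_grid_cell(1)[OF R(1)]] dyadic_grid_cell(4)[OF R(1)] by auto
    note Cpos = emeasure_cube_finite_pos[OF C]
    have "average_product m g C \<le> (\<Prod>i\<in>{1..m}. 6 ^ CARD('n) * ((\<integral>\<^sup>+y\<in>R. ennreal \<bar>g i y\<bar> \<partial>lebesgue) / emeasure lebesgue R))"
      unfolding average_product_def
    proof (intro prod_mono_ennreal)
      fix i
      let ?X = "\<integral>\<^sup>+y\<in>R. ennreal \<bar>g i y\<bar> \<partial>lebesgue"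
      have "(\<integral>\<^sup>+y\<in>C. ennreal \<bar>g i y\<bar> \<partial>lebesgue) / emeasure lebesgue C \<le> ?X / emeasure lebesgue C"
        using R(2) by (intro divide_right_mono_ennreal nn_integral_mono) (auto simp: indicator_def)
      also have "\<dots> \<le> 6 ^ CARD('n) * (?X / emeasure lebesgue R)"
      proof (rule divide_le_posI_ennreal[OF Cpos(1)])
        have "?X = ?X / emeasure lebesgue R * emeasure lebesgue R"
          using Rpos by (simp add: ennreal_divide_times zero_less_iff_neq_zero)
        also have "\<dots> \<le> ?X / emeasure lebesgue R * (6 ^ CARD('n) * emeasure lebesgue C)"
          by (intro mult_left_mono R(3)) simp
        also have "\<dots> = emeasure lebesgue C * (6 ^ CARD('n) * (?X / emeasure lebesgue R))"
          by (simp only: mult_ac)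
        finally show "?X \<le> emeasure lebesgue C * (6 ^ CARD('n) * (?X / emeasure lebesgue R))" .
      qed
      finally show "(\<integral>\<^sup>+y\<in>C. ennreal \<bar>g i y\<bar> \<partial>lebesgue) / emeasure lebesgue C
        \<le> 6 ^ CARD('n) * (?X / emeasure lebesgue R)" .
    qed
    also have "\<dots> = 6 ^ (CARD('n) * m) * average_product m g R"
      unfolding prod.distrib by (simp add: average_product_def power_mult)
    finally show "\<exists>S. \<forall>x\<in>C. average_product m g C
      \<le> 6 ^ (CARD('n) * m) * family_max (dyadic_grid N (third_shift N S)) (average_product m g) x"
      using R by (intro exI[of _ S] ballI) (auto elim!: order.trans intro!: mult_left_mono family_max_upper)
  qed
qed

text \<open>The grid that serves a given cube exists only once \<open>2\<^sup>N\<close> is large compared with the cube, so the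
maximal function is bounded by a lower limit over \<open>N\<close>, and Fatou's lemma gives the integrals.\<close>

lemma nn_integral_multi_maximal_le_dyadic:
  fixes g :: "nat \<Rightarrow> real ^ 'n \<Rightarrow> real"
  assumes p: "0 < p" and v [measurable]: "v \<in> borel_measurable lebesgue"
    and dyadic: "\<And>N t. (\<integral>\<^sup>+x. epowr (family_max (dyadic_grid N t) (average_product m g) x) p
      * ennreal (v x) \<partial>lebesgue) \<le> B"
  shows "(\<integral>\<^sup>+x. epowr (multi_maximal m g x) p * ennreal (v x) \<partial>lebesgue)
    \<le> epowr (6 ^ (CARD('n) * m)) p * 2 ^ CARD('n) * B"
proof -
  define c :: ennreal where "c = epowr (6 ^ (CARD('n) * m)) p"
  define M where "M = (\<lambda>N S. family_max (dyadic_grid N (third_shift N S)) (average_product m g))"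
  define G where "G = (\<lambda>N x. \<Sum>S\<in>(UNIV :: 'n set set). c * (epowr (M N S x) p * ennreal (v x)))"
  have [measurable]: "M N S \<in> borel_measurable lebesgue" for N S
    unfolding M_def using dyadic_grid_cell(3) by (intro borel_measurable_family_max countable_dyadic_grid) auto
  have le: "epowr (multi_maximal m g x) p * ennreal (v x) \<le> liminf (\<lambda>N. G N x)" for x
  proof -
    have "epowr (average_product m g C) p * ennreal (v x) \<le> liminf (\<lambda>N. G N x)"
      if C: "C \<in> cubes" "x \<in> C" for C
    proof (rule Liminf_bounded)
      show "\<forall>\<^sub>F N in sequentially. epowr (average_product m g C) p * ennreal (v x) \<le> G N x"
        using average_product_le_dyadic[OF C(1), of m g]
      proof eventually_elim
        case (elim N)
        then obtain S where "average_product m g C \<le> 6 ^ (CARD('n) * m) * M N S x"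
          using C(2) unfolding M_def by blast
        then have "epowr (average_product m g C) p \<le> epowr (6 ^ (CARD('n) * m) * M N S x) p"
          using p by (intro epowr_mono) auto
        then have "epowr (average_product m g C) p * ennreal (v x) \<le> c * (epowr (M N S x) p * ennreal (v x))"
          unfolding epowr_mult c_def[symmetric] mult.assoc[symmetric] by (intro mult_right_mono) auto
        also have "\<dots> \<le> G N x"
          unfolding G_def by (intro member_le_sum) auto
        finally show ?case .
      qed
    qed
    then show ?thesis
      unfolding multi_maximal_eq epowr_SUP[OF p] SUP_mult_right_ennreal
      by (intro SUP_least) auto
  qed
  have "(\<integral>\<^sup>+x. epowr (multi_maximal m g x) p * ennreal (v x) \<partial>lebesgue) \<le> (\<integral>\<^sup>+x. liminf (\<lambda>N. G N x) \<partial>lebesgue)"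
    by (intro nn_integral_mono le)
  also have "\<dots> \<le> liminf (\<lambda>N. \<integral>\<^sup>+x. G N x \<partial>lebesgue)"
    unfolding G_def by (intro nn_integral_liminf) measurable
  also have "\<dots> \<le> liminf (\<lambda>N. c * 2 ^ CARD('n) * B)"
  proof (intro Liminf_mono always_eventually allI)
    fix N
    have "(\<integral>\<^sup>+x. G N x \<partial>lebesgue) = (\<Sum>S\<in>(UNIV :: 'n set set). c * (\<integral>\<^sup>+x. epowr (M N S x) p * ennreal (v x) \<partial>lebesgue))"
      unfolding G_def by (subst nn_integral_sum) (auto intro!: sum.cong nn_integral_cmult)
    also have "\<dots> \<le> (\<Sum>S\<in>(UNIV :: 'n set set). c * B)"
      unfolding M_def by (intro sum_mono mult_left_mono dyadic) auto
    also have "\<dots> = c * 2 ^ CARD('n) * B"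
      by (simp add: card_UNIV_set mult_ac)
    finally show "(\<integral>\<^sup>+x. G N x \<partial>lebesgue) \<le> c * 2 ^ CARD('n) * B" .
  qed
  also have "\<dots> = c * 2 ^ CARD('n) * B" by (simp add: Liminf_const)
  finally show ?thesis unfolding c_def .
qed

section \<open>The testing and reverse Hoelder constants\<close>

lemma ennreal_le_mult_INF:
  fixes x y :: ennreal
  assumes x: "x < top" and le: "\<And>c. c \<in> A \<Longrightarrow> y \<le> x * ennreal c" and ne: "A \<noteq> {}"
  shows "y \<le> x * (INF c\<in>A. ennreal c)"
proof (cases "x = 0")
  case True
  then show ?thesis using le ne by auto
next
  case False
  have "y / x \<le> (INF c\<in>A. ennreal c)"
    using False le by (intro INF_greatest divide_le_posI_ennreal) (auto simp: zero_less_iff_neq_zero)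
  then have "x * (y / x) \<le> x * (INF c\<in>A. ennreal c)" by (intro mult_left_mono) auto
  moreover have "x * (y / x) = y"
    using False x by (metis ennreal_times_divide less_irrefl mult.commute mult_divide_eq_ennreal)
  ultimately show ?thesis by simp
qed

lemma dual_weight_nonneg: "0 \<le> dual_weight q w x"
  by (simp add: dual_weight_def)

lemma Lnorm_indicator:
  assumes "0 < q"
  shows "Lnorm q \<sigma> (\<lambda>x. ennreal \<bar>indicator Q x\<bar>) = epowr (weight_measure \<sigma> Q) (1 / q)"
proof -
  have "(\<integral>\<^sup>+x. epowr (ennreal \<bar>indicator Q x\<bar>) q * ennreal (\<sigma> x) \<partial>lebesgue) = weight_measure \<sigma> Q"
    unfolding weight_measure_def by (intro nn_integral_cong) (auto simp: indicator_def)
  then show ?thesis by (simp add: Lnorm_def)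
qed

text \<open>Necessity of the testing condition: the inequality is applied to the functions \<open>f i = indicator Q\<close>.\<close>

lemma S_const_le_maximal_bound:
  fixes v :: "real ^ 'n \<Rightarrow> real"
  assumes P: "\<And>i. i \<in> {1..m} \<Longrightarrow> 1 < P i" and p: "0 < p"
    and w: "\<And>i. i \<in> {1..m} \<Longrightarrow> weight (dual_weight (P i) (w i))"
    and C: "maximal_bound m P p v w C"
  shows "S_const m P p v w \<le> ennreal C"
  unfolding S_const_def
proof (rule SUP_least)
  fix Q :: "(real ^ 'n) set"
  assume Q: "Q \<in> cubes"
  have [measurable]: "Q \<in> sets lebesgue" using Q by (auto elim!: cubesE)
  have Lnorm: "Lnorm (P i) (dual_weight (P i) (w i)) (\<lambda>x. ennreal \<bar>indicator Q x\<bar>)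
      = epowr (weight_measure (dual_weight (P i) (w i)) Q) (1 / P i)" if "i \<in> {1..m}" for i
    using P[OF that] by (intro Lnorm_indicator) auto
  let ?D = "\<Prod>i\<in>{1..m}. epowr (weight_measure (dual_weight (P i) (w i)) Q) (1 / P i)"
  let ?M = "multi_maximal m (\<lambda>i y. dual_weight (P i) (w i) y * indicator Q y)"
  have "indicator Q \<in> Lspace (P i) (dual_weight (P i) (w i))" if "i \<in> {1..m}" for i
    using weight_measure_cube(2)[OF w[OF that] Q]
    unfolding Lspace_def mem_Collect_eq Lnorm[OF that] by simp
  then have "Lnorm p v (multi_maximal m (\<lambda>i x. indicator Q x * dual_weight (P i) (w i) x))
      \<le> ennreal C * (\<Prod>i\<in>{1..m}. Lnorm (P i) (dual_weight (P i) (w i)) (\<lambda>x. ennreal \<bar>indicator Q x\<bar>))"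
    using C[unfolded maximal_bound_def, rule_format, of "\<lambda>_. indicator Q"] by simp
  also have "(\<Prod>i\<in>{1..m}. Lnorm (P i) (dual_weight (P i) (w i)) (\<lambda>x. ennreal \<bar>indicator Q x\<bar>)) = ?D"
    by (intro prod.cong refl Lnorm)
  finally have bound: "Lnorm p v ?M \<le> ?D * ennreal C"
    by (simp only: mult.commute)
  have "epowr (\<integral>\<^sup>+x\<in>Q. epowr (?M x) p * ennreal (v x) \<partial>lebesgue) (1 / p) \<le> Lnorm p v ?M"
    unfolding Lnorm_def using p by (intro epowr_mono nn_integral_mono) (auto simp: indicator_def)
  also note bound
  finally have "epowr (\<integral>\<^sup>+x\<in>Q. epowr (?M x) p * ennreal (v x) \<partial>lebesgue) (1 / p) \<le> ?D * ennreal C" .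
  moreover have "0 < ?D"
    using weight_measure_cube(1)[OF w Q] by (simp add: zero_less_iff_neq_zero)
  ultimately show "epowr (\<integral>\<^sup>+x\<in>Q. epowr (?M x) p * ennreal (v x) \<partial>lebesgue) (1 / p) / ?D \<le> ennreal C"
    by (intro divide_le_posI_ennreal)
qed

text \<open>By Hoelder's inequality the right-hand side of the reverse inequality, without its constant, never
exceeds the left-hand side. In particular the constant does not vanish, which matters when it is
multiplied by an infinite testing constant.\<close>

lemma RH_const_ge_1:
  fixes w :: "nat \<Rightarrow> real ^ 'n \<Rightarrow> real"
  assumes P: "\<And>i. i \<in> {1..m} \<Longrightarrow> 1 < P i" "1 / p = (\<Sum>i\<in>{1..m}. 1 / P i)" "0 < p"
    and w: "\<And>i. i \<in> {1..m} \<Longrightarrow> weight (dual_weight (P i) (w i))"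
  shows "1 \<le> RH_const m P p w"
  unfolding RH_const_def
proof (rule INF_greatest)
  fix C assume C: "C \<in> {C. 0 < C \<and> RH_bound m P p w C}"
  \<comment> \<open>a single cube already forces \<open>1 \<le> C\<close>\<close>
  define Q :: "(real ^ 'n) set" where "Q = cbox 0 (0 + (\<chi> i. 1))"
  have Q: "Q \<in> cubes" unfolding Q_def cubes_def using zero_less_one by blast
  define \<sigma> where "\<sigma> = (\<lambda>i. dual_weight (P i) (w i))"
  have [measurable]: "i \<in> {1..m} \<Longrightarrow> \<sigma> i \<in> borel_measurable lebesgue" for i
    unfolding \<sigma>_def by (intro weight_borel_measurable w)
  have [measurable]: "Q \<in> sets lebesgue" unfolding Q_def by simp
  define X where "X = (\<Prod>i\<in>{1..m}. epowr (weight_measure (\<sigma> i) Q) (p / P i))"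
  have sum1: "(\<Sum>i\<in>{1..m}. p / P i) = 1"
  proof -
    have "(\<Sum>i\<in>{1..m}. p / P i) = p * (1 / p)" unfolding P(2) by (simp add: sum_distrib_left)
    then show ?thesis using P(3) by simp
  qed
  then have ne: "{1..m} \<noteq> {}" by (intro notI) simp
  have X: "0 < X" "X < top"
    using weight_measure_cube[OF w Q] unfolding X_def \<sigma>_def
    by (auto simp: zero_less_iff_neq_zero less_top[symmetric] ennreal_prod_eq_top) 
  have "X \<le> ennreal C * (\<integral>\<^sup>+x\<in>Q. (\<Prod>i\<in>{1..m}. ennreal (\<sigma> i x powr (p / P i))) \<partial>lebesgue)"
    using C Q unfolding RH_bound_def X_def \<sigma>_def by blast
  also have "(\<integral>\<^sup>+x\<in>Q. (\<Prod>i\<in>{1..m}. ennreal (\<sigma> i x powr (p / P i))) \<partial>lebesgue)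
    = (\<integral>\<^sup>+x. (\<Prod>i\<in>{1..m}. epowr (ennreal (\<sigma> i x) * indicator Q x) (p / P i)) \<partial>lebesgue)"
  proof (intro nn_integral_cong)
    fix x
    show "(\<Prod>i\<in>{1..m}. ennreal (\<sigma> i x powr (p / P i))) * indicator Q x
      = (\<Prod>i\<in>{1..m}. epowr (ennreal (\<sigma> i x) * indicator Q x) (p / P i))"
    proof (cases "x \<in> Q")
      case True
      then show ?thesis
        by (simp add: \<sigma>_def epowr_ennreal dual_weight_nonneg max_def)
    next
      case False
      then show ?thesis using ne by (auto simp: prod_zero_iff)
    qed
  qed
  also have "\<dots> \<le> X"
    unfolding X_def weight_measure_def
  proof (rule Hoelder_nn_integral_prod[OF _ _ sum1])
    show "0 < p / P i" if "i \<in> {1..m}" for i using P(1)[OF that] P(3) by simp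
  qed auto
  finally have "X \<le> ennreal C * X" by (simp add: mult_left_mono)
  then have "X * 1 \<le> X * ennreal C" by (simp add: mult.commute)
  then show "1 \<le> ennreal C"
    using X by (subst (asm) ennreal_mult_le_mult_iff) auto
qed

text \<open>The constant produced by the proof: \<open>6 ^ (n * m)\<close> is the loss in passing to dyadic cells, \<open>2 ^ n\<close> the number of
grids, and the last product contains the norm bounds of the weighted dyadic maximal operators.\<close>

definition strong_const :: "nat \<Rightarrow> (nat \<Rightarrow> real) \<Rightarrow> real \<Rightarrow> nat \<Rightarrow> ennreal"
  where "strong_const m P p n = epowr (epowr (6 ^ (n * m)) p * 2 ^ n) (1 / p)
    * (\<Prod>i\<in>{1..m}. epowr (ennreal (2 * (2 * P i / (P i - 1)) powr P i)) (1 / P i))"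

lemma strong_const_finite: "strong_const m P p n < top"
  by (auto simp: strong_const_def ennreal_mult_less_top less_top[symmetric] ennreal_prod_eq_top ennreal_mult_eq_top_iff
      power_eq_top_ennreal)

text \<open>The testing constant controls the left-hand side by a product of powers of \<open>\<sigma> i (Q)\<close>, and the reverse
Hoelder condition replaces this product by an integral over \<open>Q\<close>. Being an integral, the new bound
is additive over disjoint cubes; this is where the reverse Hoelder condition enters the proof.\<close>

lemma S_const_RH_bound_testing:
  fixes v :: "real ^ 'n \<Rightarrow> real"
  assumes P: "\<And>i. i \<in> {1..m} \<Longrightarrow> 1 < P i" "0 < p"
    and w: "\<And>i. i \<in> {1..m} \<Longrightarrow> weight (dual_weight (P i) (w i))"
    and C: "RH_bound m P p w C" and Q: "Q \<in> cubes"
  shows "(\<integral>\<^sup>+x\<in>Q. epowr (multi_maximal m (\<lambda>i y. dual_weight (P i) (w i) y * indicator Q y) x) p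
      * ennreal (v x) \<partial>lebesgue)
    \<le> epowr (S_const m P p v w) p * ennreal C
      * (\<integral>\<^sup>+x\<in>Q. (\<Prod>i\<in>{1..m}. ennreal (dual_weight (P i) (w i) x powr (p / P i))) \<partial>lebesgue)"
proof -
  let ?T = "\<integral>\<^sup>+x\<in>Q. epowr (multi_maximal m (\<lambda>i y. dual_weight (P i) (w i) y * indicator Q y) x) p
      * ennreal (v x) \<partial>lebesgue"
  let ?D = "\<Prod>i\<in>{1..m}. epowr (weight_measure (dual_weight (P i) (w i)) Q) (1 / P i)"
  let ?S = "S_const m P p v w"
  have D: "0 < ?D" "?D < top"
    using weight_measure_cube[OF w Q]
    by (auto simp: zero_less_iff_neq_zero less_top[symmetric] ennreal_prod_eq_top)
  have "epowr ?T (1 / p) / ?D \<le> ?S"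
    unfolding S_const_def by (rule SUP_upper[OF Q])
  then have "epowr ?T (1 / p) / ?D * ?D \<le> ?S * ?D" by (rule mult_right_mono) simp
  then have "epowr ?T (1 / p) \<le> ?S * ?D"
    using D by (simp add: ennreal_divide_times zero_less_iff_neq_zero)
  then have "?T \<le> epowr (?S * ?D) p"
    using epowr_le_iff[of "1 / p" ?T] P(2) by simp
  also have "\<dots> = epowr ?S p * (\<Prod>i\<in>{1..m}. epowr (weight_measure (dual_weight (P i) (w i)) Q) (p / P i))"
    by (simp add: epowr_mult epowr_prod epowr_epowr)
  also have "\<dots> \<le> epowr ?S p * (ennreal C
      * (\<integral>\<^sup>+x\<in>Q. (\<Prod>i\<in>{1..m}. ennreal (dual_weight (P i) (w i) x powr (p / P i))) \<partial>lebesgue))"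
    using C Q unfolding RH_bound_def by (intro mult_left_mono) auto
  finally show ?thesis by (simp add: mult.assoc)
qed

lemma Lnorm_multi_maximal_le:
  fixes v :: "real ^ 'n \<Rightarrow> real"
  assumes P: "\<And>i. i \<in> {1..m} \<Longrightarrow> 1 < P i" "1 / p = (\<Sum>i\<in>{1..m}. 1 / P i)" "0 < p"
    and v: "weight v" and w: "\<And>i. i \<in> {1..m} \<Longrightarrow> weight (dual_weight (P i) (w i))"
    and C: "RH_bound m P p w C"
    and f: "\<And>i. i \<in> {1..m} \<Longrightarrow> f i \<in> Lspace (P i) (dual_weight (P i) (w i))"
  shows "Lnorm p v (multi_maximal m (\<lambda>i x. f i x * dual_weight (P i) (w i) x))
    \<le> strong_const m P p CARD('n) * S_const m P p v w * epowr (ennreal C) (1 / p)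
      * (\<Prod>i\<in>{1..m}. Lnorm (P i) (dual_weight (P i) (w i)) (\<lambda>x. ennreal \<bar>f i x\<bar>))"
proof -
  define \<sigma> where "\<sigma> = (\<lambda>i. dual_weight (P i) (w i))"
  define K where "K = epowr (S_const m P p v w) p * ennreal C"
  define a where "a = (\<lambda>i. ennreal (2 * (2 * P i / (P i - 1)) powr P i))"
  define J where "J = (\<lambda>i. \<integral>\<^sup>+x. epowr (ennreal \<bar>f i x\<bar>) (P i) * ennreal (\<sigma> i x) \<partial>lebesgue)"
  have v' [measurable]: "v \<in> borel_measurable lebesgue" by (rule weight_borel_measurable[OF v])
  have f': "f i \<in> borel_measurable lebesgue" "J i < \<infinity>" if "i \<in> {1..m}" for i
    using f[OF that] by (auto simp: Lspace_def Lnorm_def J_def \<sigma>_def)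
  have "(\<integral>\<^sup>+x. epowr (multi_maximal m (\<lambda>i x. f i x * \<sigma> i x) x) p * ennreal (v x) \<partial>lebesgue)
    \<le> epowr (6 ^ (CARD('n) * m)) p * 2 ^ CARD('n) * (K * (\<Prod>i\<in>{1..m}. epowr (a i * J i) (p / P i)))"
  proof (rule nn_integral_multi_maximal_le_dyadic[OF P(3) v'])
    fix N and t :: "real ^ 'n"
    show "(\<integral>\<^sup>+x. epowr (family_max (dyadic_grid N t) (average_product m (\<lambda>i x. f i x * \<sigma> i x)) x) p
        * ennreal (v x) \<partial>lebesgue) \<le> K * (\<Prod>i\<in>{1..m}. epowr (a i * J i) (p / P i))"
      unfolding a_def J_def
    proof (rule dyadic_maximal_bound[OF P _ _ v'])
      show "i \<in> {1..m} \<Longrightarrow> weight (\<sigma> i)" for i unfolding \<sigma>_def by (rule w)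
      show "0 \<le> \<sigma> i x" for i x unfolding \<sigma>_def by (rule dual_weight_nonneg)
      show "i \<in> {1..m} \<Longrightarrow> f i \<in> borel_measurable lebesgue" for i by (rule f')
      show "i \<in> {1..m} \<Longrightarrow> (\<integral>\<^sup>+x. epowr (ennreal \<bar>f i x\<bar>) (P i) * ennreal (\<sigma> i x) \<partial>lebesgue) < \<infinity>" for i
        using f'(2) unfolding J_def by blast
      show "(\<integral>\<^sup>+x\<in>Q. epowr (multi_maximal m (\<lambda>i y. \<sigma> i y * indicator Q y) x) p * ennreal (v x) \<partial>lebesgue)
        \<le> K * (\<integral>\<^sup>+x\<in>Q. (\<Prod>i\<in>{1..m}. ennreal (\<sigma> i x powr (p / P i))) \<partial>lebesgue)"
        if "Q \<in> cubes" for Q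
        unfolding K_def \<sigma>_def by (rule S_const_RH_bound_testing[OF P(1,3) w C that])
    qed
  qed
  then have "Lnorm p v (multi_maximal m (\<lambda>i x. f i x * \<sigma> i x))
    \<le> epowr (epowr (6 ^ (CARD('n) * m)) p * 2 ^ CARD('n) * (K * (\<Prod>i\<in>{1..m}. epowr (a i * J i) (p / P i)))) (1 / p)"
    unfolding Lnorm_def using P(3) by (intro epowr_mono) auto
  also have "\<dots> = epowr (epowr (6 ^ (CARD('n) * m)) p * 2 ^ CARD('n)) (1 / p) * (epowr K (1 / p)
      * (\<Prod>i\<in>{1..m}. epowr (a i * J i) (1 / P i)))"
    using P(3) by (simp add: epowr_mult epowr_prod epowr_epowr mult.assoc)
  also have "epowr K (1 / p) = S_const m P p v w * epowr (ennreal C) (1 / p)"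
    using P(3) by (simp add: K_def epowr_mult epowr_epowr)
  also have "(\<Prod>i\<in>{1..m}. epowr (a i * J i) (1 / P i))
    = (\<Prod>i\<in>{1..m}. epowr (a i) (1 / P i)) * (\<Prod>i\<in>{1..m}. Lnorm (P i) (\<sigma> i) (\<lambda>x. ennreal \<bar>f i x\<bar>))"
    unfolding epowr_mult prod.distrib Lnorm_def J_def ..
  finally show ?thesis
    unfolding \<sigma>_def[symmetric] strong_const_def a_def by (simp only: mult_ac \<sigma>_def)
qed

lemma maximal_bound_of_testing:
  fixes v :: "real ^ 'n \<Rightarrow> real"
  assumes P: "\<And>i. i \<in> {1..m} \<Longrightarrow> 1 < P i" "1 / p = (\<Sum>i\<in>{1..m}. 1 / P i)" "0 < p"
    and v: "weight v" and w: "\<And>i. i \<in> {1..m} \<Longrightarrow> weight (dual_weight (P i) (w i))"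
    and C: "RH_bound m P p w C"
    and B: "strong_const m P p CARD('n) * S_const m P p v w * epowr (ennreal C) (1 / p) \<le> ennreal B"
  shows "maximal_bound m P p v w B"
  unfolding maximal_bound_def
proof (intro allI impI)
  fix f :: "nat \<Rightarrow> real ^ 'n \<Rightarrow> real"
  assume "\<forall>i\<in>{1..m}. f i \<in> Lspace (P i) (dual_weight (P i) (w i))"
  then have "Lnorm p v (multi_maximal m (\<lambda>i x. f i x * dual_weight (P i) (w i) x))
    \<le> strong_const m P p CARD('n) * S_const m P p v w * epowr (ennreal C) (1 / p)
      * (\<Prod>i\<in>{1..m}. Lnorm (P i) (dual_weight (P i) (w i)) (\<lambda>x. ennreal \<bar>f i x\<bar>))"
    by (intro Lnorm_multi_maximal_le P v w C) auto
  also have "\<dots> \<le> ennreal B * (\<Prod>i\<in>{1..m}. Lnorm (P i) (dual_weight (P i) (w i)) (\<lambda>x. ennreal \<bar>f i x\<bar>))"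
    by (intro mult_right_mono B) simp
  finally show "Lnorm p v (multi_maximal m (\<lambda>i x. f i x * dual_weight (P i) (w i) x)) \<le> \<dots>" .
qed

text \<open>The estimate holds with every admissible reverse Hoelder constant \<open>C\<close>, and the infimum over \<open>C\<close> is
taken after raising to the power \<open>p\<close>, where the dependence on \<open>C\<close> is linear.\<close>

lemma maximal_norm_le:
  fixes v :: "real ^ 'n \<Rightarrow> real"
  assumes P: "\<And>i. i \<in> {1..m} \<Longrightarrow> 1 < P i" "1 / p = (\<Sum>i\<in>{1..m}. 1 / P i)" "0 < p"
    and v: "weight v" and w: "\<And>i. i \<in> {1..m} \<Longrightarrow> weight (dual_weight (P i) (w i))"
    and RH: "RH_class m P p w" and S: "S_const m P p v w < top"
  shows "maximal_norm m P p v w \<le> strong_const m P p CARD('n) * S_const m P p v w * epowr (RH_const m P p w) (1 / p)"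
proof -
  define A where "A = {C. 0 < C \<and> RH_bound m P p w C}"
  define x where "x = strong_const m P p CARD('n) * S_const m P p v w"
  have x: "x < top" unfolding x_def using S strong_const_finite by (auto simp: ennreal_mult_less_top)
  have le: "maximal_norm m P p v w \<le> x * epowr (ennreal C) (1 / p)" if C: "C \<in> A" for C
  proof (rule ennreal_le_epsilon)
    fix e :: real assume e: "0 < e"
    \<comment> \<open>the summand \<open>e\<close> makes the bound positive even if \<open>x = 0\<close>\<close>
    define B where "B = enn2real (x * epowr (ennreal C) (1 / p)) + e"
    have B: "ennreal B = x * epowr (ennreal C) (1 / p) + ennreal e"
      unfolding B_def using e x by (simp add: ennreal_mult_less_top)
    have "maximal_bound m P p v w B"
    proof (rule maximal_bound_of_testing[OF P v w])
      show "RH_bound m P p w C" using C by (simp add: A_def)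
      show "strong_const m P p CARD('n) * S_const m P p v w * epowr (ennreal C) (1 / p) \<le> ennreal B"
        unfolding B x_def[symmetric] by simp
    qed
    moreover have "0 < B" unfolding B_def using e by (simp add: add_nonneg_pos)
    ultimately have "maximal_norm m P p v w \<le> ennreal B"
      unfolding maximal_norm_def by (intro INF_lower) simp
    then show "maximal_norm m P p v w \<le> x * epowr (ennreal C) (1 / p) + ennreal e"
      by (simp add: B)
  qed
  have "epowr (maximal_norm m P p v w) p \<le> epowr x p * (INF C\<in>A. ennreal C)"
  proof (rule ennreal_le_mult_INF)
    show "epowr x p < top" using x by simp
    show "A \<noteq> {}" using RH by (auto simp: RH_class_def A_def)
    fix C assume "C \<in> A"
    then have "epowr (maximal_norm m P p v w) p \<le> epowr (x * epowr (ennreal C) (1 / p)) p"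
      using P(3) by (intro epowr_mono le) auto
    then show "epowr (maximal_norm m P p v w) p \<le> epowr x p * ennreal C"
      using P(3) by (simp add: epowr_mult epowr_epowr)
  qed
  then have "maximal_norm m P p v w \<le> epowr (epowr x p * (INF C\<in>A. ennreal C)) (1 / p)"
    by (simp only: epowr_le_iff[OF P(3)])
  also have "\<dots> = x * epowr (RH_const m P p w) (1 / p)"
    using P(3) by (simp add: epowr_mult epowr_epowr RH_const_def A_def)
  finally show ?thesis by (simp add: x_def)
qed

theorem theorem3p2:
  fixes m :: nat and P :: "nat \<Rightarrow> real" and p :: real
  assumes "1 \<le> m"
    and "\<And>i. i \<in> {1..m} \<Longrightarrow> 1 < P i"
    and "1 / p = (\<Sum>i\<in>{1..m}. 1 / P i)"
  shows "\<exists>c>0. \<forall>(v :: real ^ 'n \<Rightarrow> real) w.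
    weight v \<longrightarrow>
    (\<forall>i\<in>{1..m}. weight (w i) \<and> weight (dual_weight (P i) (w i))) \<longrightarrow>
    RH_class m P p w \<longrightarrow>
      ((\<exists>C>0. maximal_bound m P p v w C) \<longleftrightarrow> S_class m P p v w) \<and>
      S_const m P p v w \<le> ennreal c * maximal_norm m P p v w \<and>
      maximal_norm m P p v w \<le> ennreal c * S_const m P p v w * epowr (RH_const m P p w) (1 / p)"
proof -
  note P = assms(2,3)
  have "0 < (\<Sum>i\<in>{1..m}. 1 / P i)"
  proof (rule sum_pos)
    show "0 < 1 / P i" if "i \<in> {1..m}" for i using P(1)[OF that] by simp
  qed (use assms(1) in auto)
  then have p: "0 < p" using P(2) by (metis zero_less_divide_1_iff)
  define c where "c = 1 + enn2real (strong_const m P p CARD('n))"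
  have c: "0 < c" "1 \<le> ennreal c" "strong_const m P p CARD('n) \<le> ennreal c"
  proof -
    show "0 < c" "1 \<le> ennreal c" by (auto simp: c_def add_pos_nonneg)
    have "ennreal c = 1 + strong_const m P p CARD('n)"
      using strong_const_finite[of m P p "CARD('n)"] by (simp add: c_def)
    then show "strong_const m P p CARD('n) \<le> ennreal c" by simp
  qed
  show ?thesis
  proof (intro exI[of _ c] conjI c(1) allI impI)
    fix v :: "real ^ 'n \<Rightarrow> real" and w :: "nat \<Rightarrow> real ^ 'n \<Rightarrow> real"
    assume v: "weight v" and ww: "\<forall>i\<in>{1..m}. weight (w i) \<and> weight (dual_weight (P i) (w i))"
      and RH: "RH_class m P p w"
    have w: "weight (dual_weight (P i) (w i))" if "i \<in> {1..m}" for i using ww that by blast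
    have upper: "S_const m P p v w \<le> ennreal C" if "maximal_bound m P p v w C" for C
      using P(1) p w that by (rule S_const_le_maximal_bound)
    have strong: "maximal_norm m P p v w
        \<le> strong_const m P p CARD('n) * S_const m P p v w * epowr (RH_const m P p w) (1 / p)"
      if "S_const m P p v w < top"
      using P p v w RH that by (rule maximal_norm_le)
    show "(\<exists>C>0. maximal_bound m P p v w C) \<longleftrightarrow> S_class m P p v w"
    proof
      assume "\<exists>C>0. maximal_bound m P p v w C"
      then show "S_class m P p v w"
        unfolding S_class_def using upper by (metis ennreal_less_top infinity_ennreal_def le_less_trans)
    next
      assume S: "S_class m P p v w"
      obtain C where C: "0 < C" "RH_bound m P p w C" using RH by (auto simp: RH_class_def)
      let ?B = "strong_const m P p CARD('n) * S_const m P p v w * epowr (ennreal C) (1 / p)"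
      have "?B < top"
        using S strong_const_finite by (auto simp: S_class_def ennreal_mult_less_top)
      then have "?B \<le> ennreal (enn2real ?B + 1)" by simp
      with P p v w C(2) have "maximal_bound m P p v w (enn2real ?B + 1)"
        by (rule maximal_bound_of_testing)
      moreover have "0 < enn2real ?B + 1" by (simp add: add_nonneg_pos)
      ultimately show "\<exists>C>0. maximal_bound m P p v w C" by blast
    qed
    have "S_const m P p v w \<le> maximal_norm m P p v w"
      unfolding maximal_norm_def using upper by (intro INF_greatest) auto
    also have "\<dots> \<le> ennreal c * maximal_norm m P p v w"
      using mult_right_mono[OF c(2), of "maximal_norm m P p v w"] by simp
    finally show "S_const m P p v w \<le> ennreal c * maximal_norm m P p v w" .
    show "maximal_norm m P p v w \<le> ennreal c * S_const m P p v w * epowr (RH_const m P p w) (1 / p)"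
    proof (cases "S_const m P p v w < top")
      case True
      show ?thesis
        by (rule order.trans[OF strong[OF True]]) (intro mult_right_mono c(3), simp_all)
    next
      case False
      \<comment> \<open>the right-hand side is infinite, as no factor vanishes\<close>
      have "RH_const m P p w \<noteq> 0" using RH_const_ge_1[OF P p w] by auto
      then have "ennreal c * S_const m P p v w * epowr (RH_const m P p w) (1 / p) = top"
        using False c(1) by (simp add: less_top[symmetric] ennreal_mult_eq_top_iff)
      then show ?thesis by simp
    qed
  qed
qed

end
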